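(* Fix $r_H$, $J$, $v$, $\xi$, $C$, a time $\tau\ge 0$ and circuit depths $d_V$ and $\{d_{W_k}\}_{k=0}^{N-1}$, and put $R=4(d_V+\max_k d_{W_k})$. There is a constant $K$, depending only on these data (in particular not on $L$, $\tilde L$, $l_0$ or the particular gates), such that the following holds. Let $H^{(L)}$ be a Hamiltonian on $L$ qubits with interaction range $r_H$ and local strength at most $J$, satisfying, together with its local restrictions, the Lieb--Robinson bound with constants $(C,v,\xi)$. Let $V^{(L)}(\boldsymbol\theta)$ be a parametrized brick-wall circuit of depth $d_V$ and $W^{(L)}_k$ ($k=0,\dots,N-1$) brick-wall circuits of depths $d_{W_k}$, and let $B_{\mathcal S}=\{|\Psi_k\rangle\}_{k=0}^{N-1}$ with $|\Psi_k\rangle=W_k^{(L)}|0\rangle^{\otimes L}$. Let $l_0\ge0$, $$L' = 2\Bigl(l_0 + r_H + v\tau + 2\bigl(d_V + \max_{k} d_{W_k}\bigr)\Bigr)<L,$$ and let $\tilde L>L'$ satisfy $$\tilde L \ge \max\Bigl( \frac{L'}{2}+2\bigl(d_V+\max_k d_{W_k}\bigr)+1,\; L'+4\max_k d_{W_k}\Bigr).$$ Define the local subsystem cost function $$C^{(\tilde L),B_{\mathcal S}}(\boldsymbol\theta)=\frac1L\sum_{j=1}^{L}C_{\rm LLET}^{(j),B_{\tilde{\mathcal S}_j}}\bigl(U_\tau^{(\tilde L,j)},V^{(\tilde L,j)}(\boldsymbol\theta)\bigr).$$ If $C^{(\tilde L),B_{\mathcal S}}(\boldsymbol\theta^* )\le\epsilon_{\rm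 opt}$ for some parameter set $\boldsymbol\theta^*$, then, with $\epsilon_{\rm LR}=K\,e^{-(l_0+R/2)/\xi}$, $$C_{\rm LLET}^{B_{\mathcal S}}\bigl(U_{\tau}^{(L)},V^{(L)}(\boldsymbol\theta^* )\bigr) \le \epsilon_{\rm opt} + \epsilon_{\rm LR},$$ $$C_{\rm LET}^{B_{\mathcal S}}\bigl(U_{\tau}^{(L)},V^{(L)}(\boldsymbol\theta^* )\bigr) \le L\,(\epsilon_{\rm opt} + \epsilon_{\rm LR}).$$
   Context: Lattice: $\Lambda=\{1,\dots,L\}$ with $L$ even, one qubit per site, $\mathrm{dist}(i,j)=|i-j|$, $\mathrm{dist}(X,Y)=\min_{x\in X,y\in Y}\mathrm{dist}(x,y)$. $\|\cdot\|$ is the operator norm. Hamiltonian: $H^{(L)}=\sum_{X\subseteq\Lambda}H_X$, each $H_X$ Hermitian and acting nontrivially only on $X$. Range $r_H$: $H_X=0$ unless the diameter of $X$ is at most $r_H$. Local strength at most $J$: $\sum_{X\ni i}\|H_X\|\le J$ for every site $i$. Write $U^{(L)}_{\tau}=e^{-i\tau H^{(L)}}$. Local restriction: for a real number $\ell>0$ and a site $j$, $\Lambda^{(\ell,j)}=\{j'\in\Lambda:\mathrm{dist}(j,j')\le \ell/2\}$ and $H^{(\ell,j)}=\sum_{X\subseteq\Lambda^{(\ell,j)}}H_X$. In the local subsystem cost, $U_\tau^{(\tilde L,j)}=e^{-i\tau H^{(\tilde L,j)}}$ is regarded as a unitary on the qubits of $\Lambda^{(\tilde L,j)}$. Lieb--Robinson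 bound with constants $(C,v,\xi)$ (with $v\ge0$, $\xi>0$) for a Hamiltonian $G$: for all $|s|\le\tau$ and all operators $O_X,O_Y$ of operator norm at most $1$ supported on $X,Y$, $$\bigl\|[e^{isG}O_Xe^{-isG},O_Y]\bigr\|\le C e^{-[\mathrm{dist}(X,Y)-v|s|]/\xi}.$$ It is assumed for $G=H^{(L)}$ and for all its local restrictions $G=H^{(\ell,j)}$; the constants do not depend on the system size ($C$ may depend on $\tau$). Brick-wall circuit of depth $d$: a unitary of the form $\prod_{l=1}^{d}\bigl[\bigl(\prod_{i=1}^{L/2}g^{(l)}_{2i-1,2i}\bigr)\bigl(\prod_{i=1}^{L/2-1}g^{(l)}_{2i,2i+1}\bigr)\bigr]$, where $g^{(l)}_{i,i+1}$ is a two-qubit unitary acting nontrivially only on sites $i,i+1$. For $V^{(L)}(\boldsymbol\theta)$ the gates are $v^{(l)}_{i,i+1}(\theta_i^{(l)})$ with $\boldsymbol\theta=\{\theta_i^{(l)}\}_{i,l}$. The local restriction of such a circuit to $\Lambda^{(\tilde L,j)}$, written $V^{(\tilde L,j)}(\boldsymbol\theta)$ or $W_k^{(\tilde L,j)}$, is the circuit on the qubits of $\Lambda^{(\tilde L,j)}$ obtained by the same product, in the same order, keeping only the gates whose two sites both lie in $\Lambda^{(\tilde L,j)}$. Put $B_{\tilde{\mathcal S}_j}=\{W_k^{(\tilde L,j)}|0\rangle^{\otimes\tilde L}\}_{k=0}^{N-1}$, where $|0\rangle^{\otimes\tilde L}$ denotes the all-zero state of the qubits of $\Lambda^{(\tilde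 L,j)}$. The states $|\Psi_k\rangle$, $k=0,\dots,N-1$, are assumed linearly independent and pairwise nonorthogonal. Costs: for a set of qubits $\Lambda_0$ containing $j$, unitaries $U,V$ on $\Lambda_0$, and a family $B=\{W_k|0\cdots0\rangle\}_{k=0}^{N-1}$ given by unitaries $W_k$ on $\Lambda_0$, with $\Pi_j$ the projector $|0\rangle\langle 0|$ on qubit $j$ tensored with the identity elsewhere, $$C_{\rm LLET}^{(j),B}(U,V)=1-\frac1N\sum_{k=0}^{N-1}\langle 0\cdots0|W_k^\dagger U^{\dagger}VW_k\,\Pi_j\,W_k^\dagger V^{\dagger}UW_k|0\cdots0\rangle .$$ For the full system ($\Lambda_0=\Lambda$, circuits $W_k^{(L)}$), $$C_{\rm LLET}^{B_{\mathcal S}}(U,V)=\frac1L\sum_{j=1}^{L}C_{\rm LLET}^{(j),B_{\mathcal S}}(U,V),\qquad C_{\rm LET}^{B_{\mathcal S}}(U,V)=1-\frac1N\sum_{k=0}^{N-1}\bigl|\langle\Psi_k|V^\dagger U|\Psi_k\rangle\bigr|^2 .$$ For $B_{\tilde{\mathcal S}_j}$, $\Lambda_0=\Lambda^{(\tilde L,j)}$ with the circuits $W_k^{(\tilde L,j)}$. *)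

theory Defs
  imports "HOL-Analysis.Analysis"
begin

text \<open>
  Sites are natural numbers. A computational basis state of the qubits of a finite set \<open>S\<close> of sites
  is given by the set \<open>x \<subseteq> S\<close> of the sites that are in state 1. State vectors of these qubits
  are therefore indexed by \<open>Pow S\<close>, and operators on them are complex matrices whose rows and columns
  are indexed by \<open>Pow S\<close>. Vectors and matrices are total functions; values outside \<open>Pow S\<close> are
  irrelevant. With this indexing the tensor factorisation over a partition of \<open>S\<close> is
  just disjoint union of index sets, and no enumeration of basis states is needed.
\<close>

type_synonym qvec = "nat set \<Rightarrow> complex"
type_synonym qop = "nat set \<Rightarrow> nat set \<Rightarrow> complex"

definition op_one :: qop where
  "op_one = (\<lambda>x y. if x = y then 1 else 0)"

definition op_mult :: "nat set \<Rightarrow> qop \<Rightarrow> qop \<Rightarrow> qop" where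
  "op_mult S A B = (\<lambda>x y. \<Sum>z\<in>Pow S. A x z * B z y)"

definition op_prod :: "nat set \<Rightarrow> qop list \<Rightarrow> qop" where
  "op_prod S As = foldr (op_mult S) As op_one"

definition op_adj :: "qop \<Rightarrow> qop" where
  "op_adj A = (\<lambda>x y. cnj (A y x))"

definition op_apply :: "nat set \<Rightarrow> qop \<Rightarrow> qvec \<Rightarrow> qvec" where
  "op_apply S A \<psi> = (\<lambda>x. \<Sum>y\<in>Pow S. A x y * \<psi> y)"

definition braket :: "nat set \<Rightarrow> qvec \<Rightarrow> qvec \<Rightarrow> complex" where
  "braket S \<phi> \<psi> = (\<Sum>x\<in>Pow S. cnj (\<phi> x) * \<psi> x)"

definition vec_norm :: "nat set \<Rightarrow> qvec \<Rightarrow> real" where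
  "vec_norm S \<psi> = L2_set (\<lambda>x. cmod (\<psi> x)) (Pow S)"

definition opnorm :: "nat set \<Rightarrow> qop \<Rightarrow> real" where
  "opnorm S A = (SUP \<psi>\<in>{\<psi>. vec_norm S \<psi> \<le> 1}. vec_norm S (op_apply S A \<psi>))"

definition op_exp :: "nat set \<Rightarrow> qop \<Rightarrow> qop" where
  "op_exp S A = (\<lambda>x y. \<Sum>n. op_prod S (replicate n A) x y / fact n)"

definition hermitian :: "nat set \<Rightarrow> qop \<Rightarrow> bool" where
  "hermitian S A \<longleftrightarrow> (\<forall>x\<in>Pow S. \<forall>y\<in>Pow S. op_adj A x y = A x y)"

definition unitary :: "nat set \<Rightarrow> qop \<Rightarrow> bool" where
  "unitary S U \<longleftrightarrow> (\<forall>x\<in>Pow S. \<forall>y\<in>Pow S.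
     op_mult S (op_adj U) U x y = op_one x y \<and> op_mult S U (op_adj U) x y = op_one x y)"

text \<open>
  The operator \<open>a\<close> on the qubits of \<open>X\<close>, tensored with the identity on all other sites. Its entries
  do not refer to the ambient set, so the same function represents
  the extension of \<open>a\<close> to the qubits of any \<open>S \<supseteq> X\<close>. In particular the operators on the qubits of
  \<open>S\<close> that act nontrivially only on \<open>X\<close> are those of the form \<open>tens_id X a\<close>.
\<close>

definition tens_id :: "nat set \<Rightarrow> qop \<Rightarrow> qop" where
  "tens_id X a = (\<lambda>x y. if x - X = y - X then a (x \<inter> X) (y \<inter> X) else 0)"

definition ket0 :: qvec where
  "ket0 = (\<lambda>x. if x = {} then 1 else 0)"

definition proj0 :: "nat \<Rightarrow> qop" where
  "proj0 j = tens_id {j} (\<lambda>x y. if x = {} \<and> y = {} then 1 else 0)"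


definition chain :: "nat \<Rightarrow> nat set" where
  "chain L = {1..L}"

definition region :: "nat \<Rightarrow> real \<Rightarrow> nat \<Rightarrow> nat set" where
  "region L l j = {j' \<in> chain L. dist (real j) (real j') \<le> l / 2}"

text \<open>
  A Hamiltonian is given by its local terms: \<open>h X\<close> is an operator on the qubits of \<open>X\<close>, and
  \<open>tens_id X (h X)\<close> is the term \<open>H\<^sub>X\<close>. The operator \<open>ham h S\<close> sums the terms with \<open>X \<subseteq> S\<close>; it can be
  used both on the qubits of \<open>S\<close> and on those of a larger set.
\<close>

definition ham :: "(nat set \<Rightarrow> qop) \<Rightarrow> nat set \<Rightarrow> qop" where
  "ham h S = (\<lambda>x y. \<Sum>X\<in>Pow S. tens_id X (h X) x y)"

definition local_hamiltonian :: "nat \<Rightarrow> real \<Rightarrow> real \<Rightarrow> (nat set \<Rightarrow> qop) \<Rightarrow> bool" where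
  "local_hamiltonian L r J h \<longleftrightarrow>
     (\<forall>X\<subseteq>chain L. hermitian X (h X)) \<and>
     (\<forall>X\<subseteq>chain L. \<not> diameter (real ` X) \<le> r \<longrightarrow> tens_id X (h X) = (\<lambda>x y. 0)) \<and>
     (\<forall>i\<in>chain L. (\<Sum>X\<in>{X. X \<subseteq> chain L \<and> i \<in> X}. opnorm (chain L) (tens_id X (h X))) \<le> J)"

text \<open>\<open>evol S G t\<close> is \<open>exp (- i t G)\<close> on the qubits of \<open>S\<close>.\<close>

definition evol :: "nat set \<Rightarrow> qop \<Rightarrow> real \<Rightarrow> qop" where
  "evol S G t = op_exp S (\<lambda>x y. - \<i> * of_real t * G x y)"

definition lieb_robinson ::
  "nat set \<Rightarrow> qop \<Rightarrow> real \<Rightarrow> real \<Rightarrow> real \<Rightarrow> real \<Rightarrow> bool" where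
  "lieb_robinson S G \<tau> C v \<xi> \<longleftrightarrow>
     (\<forall>s X Y a b. \<bar>s\<bar> \<le> \<tau> \<and> X \<subseteq> S \<and> X \<noteq> {} \<and> Y \<subseteq> S \<and> Y \<noteq> {} \<and>
        opnorm S (tens_id X a) \<le> 1 \<and> opnorm S (tens_id Y b) \<le> 1 \<longrightarrow>
        (let A = op_prod S [evol S G (- s), tens_id X a, evol S G s]; B = tens_id Y b
         in opnorm S (\<lambda>x y. op_mult S A B x y - op_mult S B A x y)
              \<le> C * exp (- (setdist (real ` X) (real ` Y) - v * \<bar>s\<bar>) / \<xi>)))"


text \<open>
  In a family \<open>g\<close> of gates, \<open>g l i\<close> is the gate of layer \<open>l\<close> on the sites \<open>i, i + 1\<close>.
\<close>

definition gates :: "nat \<Rightarrow> nat \<Rightarrow> (nat \<Rightarrow> nat \<Rightarrow> qop) \<Rightarrow> bool" where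
  "gates L d g \<longleftrightarrow> (\<forall>l\<in>{1..d}. \<forall>i\<in>{1..<L}. unitary {i, Suc i} (g l i))"

text \<open>
  First sites of the gates of one layer, in the order in which the gates are multiplied:
  \<open>1, 3, \<dots>, L - 1\<close>, then \<open>2, 4, \<dots>, L - 2\<close>.
\<close>

definition brick_sites :: "nat \<Rightarrow> nat list" where
  "brick_sites L = map (\<lambda>i. 2 * i - 1) [1..<L div 2 + 1] @ map (\<lambda>i. 2 * i) [1..<L div 2]"

text \<open>
  Restriction to the qubits of \<open>S\<close> of the brick-wall circuit of depth \<open>d\<close> on \<open>L\<close> qubits. The factors
  are multiplied from left to right, with layer 1 leftmost. For \<open>S = chain L\<close> no gate is
  dropped and this is the circuit itself.
\<close>

definition brickwall :: "nat \<Rightarrow> nat \<Rightarrow> (nat \<Rightarrow> nat \<Rightarrow> qop) \<Rightarrow> nat set \<Rightarrow> qop" where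
  "brickwall L d g S = op_prod S
     [tens_id {i, Suc i} (g l i). l \<leftarrow> [1..<d + 1], i \<leftarrow> brick_sites L, {i, Suc i} \<subseteq> S]"

text \<open>
  \<open>W k\<close>, \<open>k < N\<close>, are the unitaries preparing the states of the family. The expectation value is
  real (it is a squared norm); \<open>Re\<close> only changes the type.
\<close>

definition cost_LLET :: "nat set \<Rightarrow> nat \<Rightarrow> (nat \<Rightarrow> qop) \<Rightarrow> nat \<Rightarrow> qop \<Rightarrow> qop \<Rightarrow> real" where
  "cost_LLET S N W j U V = 1 - (\<Sum>k<N. Re (braket S ket0 (op_apply S
     (op_prod S [op_adj (W k), op_adj U, V, W k, proj0 j, op_adj (W k), op_adj V, U, W k])
     ket0))) / real N"

definition cost_LLET_full :: "nat \<Rightarrow> nat \<Rightarrow> (nat \<Rightarrow> qop) \<Rightarrow> qop \<Rightarrow> qop \<Rightarrow> real" where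
  "cost_LLET_full L N W U V = (\<Sum>j=1..L. cost_LLET (chain L) N W j U V) / real L"

definition cost_LET :: "nat \<Rightarrow> nat \<Rightarrow> (nat \<Rightarrow> qvec) \<Rightarrow> qop \<Rightarrow> qop \<Rightarrow> real" where
  "cost_LET L N \<Psi> U V = 1 - (\<Sum>k<N. (cmod (braket (chain L) (\<Psi> k)
     (op_apply (chain L) (op_prod (chain L) [op_adj V, U]) (\<Psi> k))))\<^sup>2) / real N"

text \<open>
  The local subsystem cost for gates \<open>gV\<close> of depth \<open>dV\<close> and state preparation gates \<open>gW k\<close> of depth
  \<open>dW k\<close>; \<open>l\<close> is the size of the local subsystems.
\<close>

definition cost_local ::
  "nat \<Rightarrow> real \<Rightarrow> (nat set \<Rightarrow> qop) \<Rightarrow> real \<Rightarrow> nat \<Rightarrow> (nat \<Rightarrow> nat) \<Rightarrow> (nat \<Rightarrow> nat \<Rightarrow> nat \<Rightarrow> qop) \<Rightarrow>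
   nat \<Rightarrow> (nat \<Rightarrow> nat \<Rightarrow> qop) \<Rightarrow> real" where
  "cost_local L l h \<tau> N dW gW dV gV = (\<Sum>j=1..L. let S = region L l j in
     cost_LLET S N (\<lambda>k. brickwall L (dW k) (gW k) S) j
       (evol S (ham h S) \<tau>) (brickwall L dV gV S)) / real L"

definition lin_indep :: "nat set \<Rightarrow> nat \<Rightarrow> (nat \<Rightarrow> qvec) \<Rightarrow> bool" where
  "lin_indep S N \<Psi> \<longleftrightarrow>
     (\<forall>c :: nat \<Rightarrow> complex. (\<forall>x\<in>Pow S. (\<Sum>k<N. c k * \<Psi> k x) = 0) \<longrightarrow> (\<forall>k<N. c k = 0))"

definition pairwise_nonorth :: "nat set \<Rightarrow> nat \<Rightarrow> (nat \<Rightarrow> qvec) \<Rightarrow> bool" where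
  "pairwise_nonorth S N \<Psi> \<longleftrightarrow> (\<forall>k<N. \<forall>k'<N. k \<noteq> k' \<longrightarrow> braket S (\<Psi> k) (\<Psi> k') \<noteq> 0)"

end

theory Submission
  imports Defs
begin

text \<open>
  With \<open>A = V W\<^sub>k \<Pi>\<^sub>j W\<^sub>k\<^sup>\<dagger> V\<^sup>\<dagger>\<close>, the \<open>k\<close>-th term of the cost at site \<open>j\<close> is the expectation of
  \<open>U\<^sup>\<dagger> A U\<close> in the state \<open>W\<^sub>k |0\<dots>0\<rangle>\<close>. By the light cone of the brick wall, \<open>A\<close> is supported within
  distance \<open>R / 2\<close> of \<open>j\<close> and does not see the gates dropped by the restriction. Let \<open>S'\<close> be the region of
  size \<open>Lt - 4 D\<close> around \<open>j\<close>. By Duhamel's formula, replacing the Hamiltonian of any region containing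
  \<open>S'\<close> by that of \<open>S'\<close> in the evolution of \<open>A\<close> costs only commutators of the evolved \<open>A\<close> with the
  terms straddling the boundary of \<open>S'\<close>; these are of order \<open>exp (- l\<^sub>0 / \<xi>)\<close> by the Lieb-Robinson bound,
  and \<open>K\<close> contains the factor \<open>exp (R / (2 \<xi>))\<close> that turns this into \<open>exp (- (l\<^sub>0 + R / 2) / \<xi>)\<close>.
  The operator evolved in \<open>S'\<close> has the same expectation in the full and in the restricted circuit
  states, since the light cone of \<open>W\<^sub>k\<close> from \<open>S'\<close> stays in the local subsystem. Hence the full and the local cost are both compared with the evolution in \<open>S'\<close>.

  The bound on the LET cost is the union bound for measuring some qubit in state 1.

  To handle operators on different sets of qubits at once, all of them are embedded into
  one unital *-algebra, that of the local operators on infinitely many qubits.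
\<close>

section \<open>The algebra of local operators\<close>

lemma tens_id_tens_id: "X \<subseteq> S \<Longrightarrow> tens_id S (tens_id X a) = tens_id X a"
proof (intro ext)
  fix x y assume X: "X \<subseteq> S"
  have 1: "x - X = y - X \<longleftrightarrow> x - S = y - S \<and> x \<inter> S - X = y \<inter> S - X"
    using X by blast
  have 2: "x \<inter> S \<inter> X = x \<inter> X" "y \<inter> S \<inter> X = y \<inter> X"
    using X by blast+
  show "tens_id S (tens_id X a) x y = tens_id X a x y"
    unfolding tens_id_def 2 1 by auto
qed

lemma tens_id_cong:
  assumes "\<And>x y. x \<subseteq> X \<Longrightarrow> y \<subseteq> X \<Longrightarrow> a x y = b x y"
  shows "tens_id X a = tens_id X b"
  unfolding tens_id_def using assms by (intro ext) auto

lemma tens_id_subset: "x \<subseteq> X \<Longrightarrow> y \<subseteq> X \<Longrightarrow> tens_id X a x y = a x y"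
  by (auto simp: tens_id_def Int_absorb2)

lemma tens_id_op_one: "tens_id X op_one = op_one"
  unfolding tens_id_def op_one_def by (intro ext) auto

lemma tens_id_op_adj: "tens_id X (op_adj a) = op_adj (tens_id X a)"
  unfolding tens_id_def op_adj_def by (intro ext) auto

lemma tens_id_nz: "tens_id X a x y \<noteq> 0 \<Longrightarrow> y - X = x - X"
  by (auto simp: tens_id_def split: if_splits)

text \<open>The class of configurations that agree with \<open>x\<close> outside \<open>S\<close>.
  An operator on the qubits of \<open>S\<close> connects \<open>x\<close> only to these, so sums
  over intermediate states are finite even when \<open>x\<close> is an infinite set.\<close>

definition fib :: "nat set \<Rightarrow> nat set \<Rightarrow> nat set set" where
  "fib S x = {z. z - S = x - S}"

lemma fib_eq_image: "fib S x = (\<lambda>w. (x - S) \<union> w) ` Pow S"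
proof
  show "fib S x \<subseteq> (\<lambda>w. (x - S) \<union> w) ` Pow S"
  proof
    fix z assume "z \<in> fib S x"
    then have "z = (x - S) \<union> (z \<inter> S)" by (auto simp: fib_def)
    then show "z \<in> (\<lambda>w. (x - S) \<union> w) ` Pow S" by blast
  qed
qed (auto simp: fib_def)

lemma finite_fib [simp]: "finite S \<Longrightarrow> finite (fib S x)"
  by (simp add: fib_eq_image)

lemma card_fib: "card (fib S x) = card (Pow S)"
  unfolding fib_eq_image by (rule card_image) (auto simp: inj_on_def)

lemma sum_fib: "(\<Sum>z\<in>fib S x. f z) = (\<Sum>w\<in>Pow S. f ((x - S) \<union> w))"
proof -
  have "inj_on (\<lambda>w. (x - S) \<union> w) (Pow S)"
    by (auto simp: inj_on_def)
  then show ?thesis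
    unfolding fib_eq_image by (simp add: sum.reindex)
qed

lemma fib_subset: "x \<subseteq> S \<Longrightarrow> fib S x = Pow S"
  by (auto simp: fib_def)

lemma fib_cong: "z \<in> fib S x \<Longrightarrow> fib S z = fib S x"
  by (auto simp: fib_def)

lemma fib_self: "x \<in> fib S x"
  by (simp add: fib_def)

text \<open>Indices are arbitrary, possibly infinite, sets of sites, and the support is not part of
  an element. Extending an operator by identities to more qubits gives the same element, so
  operators on different regions can be multiplied or subtracted directly.\<close>

typedef locop = "{A :: qop. \<exists>S. finite S \<and> tens_id S A = A}"
  morphisms entry Abs_locop
proof
  show "op_one \<in> {A :: qop. \<exists>S. finite S \<and> tens_id S A = A}"
    using tens_id_op_one[of "{}"] by blast
qed

text \<open>\<open>S\<close> is only an upper bound for the set of sites acted on; it may be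
  enlarged as long as it stays finite.\<close>

definition supp :: "nat set \<Rightarrow> locop \<Rightarrow> bool" where
  "supp S A \<longleftrightarrow> finite S \<and> tens_id S (entry A) = entry A"

lemma supp_exists: "\<exists>S. supp S A"
  using entry[of A] by (auto simp: supp_def)

lemma supp_mono: "supp X A \<Longrightarrow> X \<subseteq> S \<Longrightarrow> finite S \<Longrightarrow> supp S A"
  unfolding supp_def by (metis tens_id_tens_id)

lemma supp_finite: "supp S A \<Longrightarrow> finite S"
  by (simp add: supp_def)

lemma supp_common2: "\<exists>S. supp S A \<and> supp S B"
proof -
  obtain X Y where "supp X A" "supp Y B" using supp_exists by meson
  then show ?thesis
    by (intro exI[of _ "X \<union> Y"]) (auto intro: supp_mono dest: supp_finite)
qed

lemma supp_common3: "\<exists>S. supp S A \<and> supp S B \<and> supp S C"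
proof -
  obtain X Y where "supp X A" "supp X B" "supp Y C" using supp_exists supp_common2 by meson
  then show ?thesis
    by (intro exI[of _ "X \<union> Y"]) (auto intro: supp_mono dest: supp_finite)
qed

lemma locop_eqI: "(\<And>x y. entry A x y = entry B x y) \<Longrightarrow> A = B"
  by (metis entry_inject ext)

lemma entry_nz: "supp S A \<Longrightarrow> entry A x y \<noteq> 0 \<Longrightarrow> y \<in> fib S x"
  unfolding supp_def fib_def by (metis (mono_tags) mem_Collect_eq tens_id_nz)

lemma entry_supp: "supp S A \<Longrightarrow> entry A x y = (if x - S = y - S then entry A (x \<inter> S) (y \<inter> S) else 0)"
  unfolding supp_def by (metis tens_id_def)

lemma suppI:
  assumes "finite S"
    and "\<And>x y. x - S \<noteq> y - S \<Longrightarrow> entry A x y = 0"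
    and "\<And>x y. x - S = y - S \<Longrightarrow> entry A x y = entry A (x \<inter> S) (y \<inter> S)"
  shows "supp S A"
  unfolding supp_def tens_id_def using assms by (auto simp: fun_eq_iff)

lemma locop_eqI_supp:
  assumes "supp S A" "supp S B" "\<And>x y. x \<subseteq> S \<Longrightarrow> y \<subseteq> S \<Longrightarrow> entry A x y = entry B x y"
  shows "A = B"
  using assms unfolding supp_def by (metis entry_inject tens_id_cong)

definition lift :: "nat set \<Rightarrow> qop \<Rightarrow> locop" where
  "lift S A = Abs_locop (tens_id S A)"

lemma entry_lift: "finite S \<Longrightarrow> entry (lift S A) = tens_id S A"
  unfolding lift_def by (subst Abs_locop_inverse) (auto intro: tens_id_tens_id)

lemma entry_lift_subset [simp]:
  "finite S \<Longrightarrow> x \<subseteq> S \<Longrightarrow> y \<subseteq> S \<Longrightarrow> entry (lift S A) x y = A x y"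
  by (simp add: entry_lift tens_id_subset)

lemma supp_lift: "finite S \<Longrightarrow> supp S (lift S A)"
  by (simp add: supp_def entry_lift tens_id_tens_id)

lemma lift_tens_id: "finite S \<Longrightarrow> X \<subseteq> S \<Longrightarrow> lift S (tens_id X a) = lift X a"
  by (simp add: lift_def tens_id_tens_id)

lemma lift_cong:
  "(\<And>x y. x \<subseteq> S \<Longrightarrow> y \<subseteq> S \<Longrightarrow> A x y = B x y) \<Longrightarrow> lift S A = lift S B"
  unfolding lift_def by (metis tens_id_cong)

lemma lift_entry: "supp S A \<Longrightarrow> lift S (entry A) = A"
  by (simp add: supp_def lift_def entry_inverse)

text \<open>Matrix multiplication needs no ambient set of sites, because the rows are finitely supported.\<close>

definition mult_entry :: "locop \<Rightarrow> locop \<Rightarrow> qop" where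
  "mult_entry A B = (\<lambda>x y. \<Sum>z | entry A x z \<noteq> 0. entry A x z * entry B z y)"

lemma mult_entry_fib:
  assumes "supp S A"
  shows "mult_entry A B x y = (\<Sum>z\<in>fib S x. entry A x z * entry B z y)"
  unfolding mult_entry_def
  by (rule sum.mono_neutral_left) (use assms in \<open>auto intro: entry_nz dest: supp_finite\<close>)

text \<open>Intermediate states have the form \<open>(x - S) \<union> w\<close> with
  \<open>w\<close> inside \<open>S\<close>. The part outside \<open>S\<close> is a spectator in both
  factors and drops out; if \<open>x\<close> and \<open>y\<close> differ there, the second factor
  vanishes.\<close>

lemma tens_id_mult_entry:
  assumes A: "supp S A" and B: "supp S B"
  shows "tens_id S (mult_entry A B) = mult_entry A B"
proof (intro ext)
  fix x y
  show "tens_id S (mult_entry A B) x y = mult_entry A B x y"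
  proof (cases "x - S = y - S")
    case True
    have "entry A ((x - S) \<union> (x \<inter> S)) ((x - S) \<union> w) * entry B ((x - S) \<union> w) y =
        entry A (x \<inter> S) w * entry B w (y \<inter> S)" if w: "w \<in> Pow S" for w
    proof -
      have "(x - S) \<union> (x \<inter> S) = x" "((x - S) \<union> w) - S = x - S" "((x - S) \<union> w) \<inter> S = w"
        using w by auto
      then show ?thesis
        by (simp add: entry_supp[OF A, of x] entry_supp[OF B, of _ y] True)
    qed
    moreover have "(x - S) \<union> (x \<inter> S) = x" by auto
    ultimately have "mult_entry A B x y = (\<Sum>w\<in>Pow S. entry A (x \<inter> S) w * entry B w (y \<inter> S))"
      by (simp add: mult_entry_fib[OF A] sum_fib)
    also have "\<dots> = mult_entry A B (x \<inter> S) (y \<inter> S)"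
      by (simp add: mult_entry_fib[OF A] fib_subset)
    finally have "mult_entry A B x y = mult_entry A B (x \<inter> S) (y \<inter> S)" .
    then show ?thesis using True by (simp add: tens_id_def)
  next
    case False
    have "entry A x z * entry B z y = 0" if "z \<in> fib S x" for z
      using that False entry_nz[OF B, of z y] by (auto simp: fib_def)
    then have "mult_entry A B x y = 0"
      unfolding mult_entry_fib[OF A] by (intro sum.neutral) blast
    then show ?thesis using False by (simp add: tens_id_def)
  qed
qed

text \<open>The condition \<open>f 0 0 = 0\<close> keeps an entry zero when its indices differ
  outside \<open>S\<close>. Unary operations are covered by an \<open>f\<close> that ignores its
  second argument.\<close>

lemma tens_id_binop:
  assumes "f 0 0 = 0" "tens_id S A = A" "tens_id S B = B"
  shows "tens_id S (\<lambda>x y. f (A x y) (B x y)) = (\<lambda>x y. f (A x y) (B x y))"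
proof (intro ext)
  fix x y
  show "tens_id S (\<lambda>x y. f (A x y) (B x y)) x y = f (A x y) (B x y)"
    using assms(1) fun_cong[OF fun_cong[OF assms(2)], of x y] fun_cong[OF fun_cong[OF assms(3)], of x y]
    by (auto simp: tens_id_def split: if_splits)
qed

section \<open>Ring structure\<close>

instantiation locop :: ring_1
begin

definition "0 = Abs_locop (\<lambda>x y. 0)"
definition "1 = Abs_locop op_one"
definition "A + B = Abs_locop (\<lambda>x y. entry A x y + entry B x y)"
definition "- A = Abs_locop (\<lambda>x y. - entry A x y)"
definition "(A :: locop) - B = A + - B"
definition "A * B = Abs_locop (mult_entry A B)"

lemma entry_0: "entry 0 x y = 0"
  unfolding zero_locop_def by (subst Abs_locop_inverse) (auto simp: tens_id_def intro!: exI[of _ "{}"])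

lemma entry_1: "entry 1 = op_one"
  unfolding one_locop_def by (subst Abs_locop_inverse) (auto simp: tens_id_op_one intro!: exI[of _ "{}"])

lemma entry_plus: "entry (A + B) x y = entry A x y + entry B x y"
proof -
  obtain S where "supp S A" "supp S B" using supp_common2 by blast
  then have "finite S \<and> tens_id S (\<lambda>x y. entry A x y + entry B x y) = (\<lambda>x y. entry A x y + entry B x y)"
    using tens_id_binop[of "(+)"] by (simp add: supp_def)
  then show ?thesis unfolding plus_locop_def by (subst Abs_locop_inverse) auto
qed

lemma entry_uminus: "entry (- A) x y = - entry A x y"
proof -
  obtain S where "supp S A" using supp_exists by blast
  then have "finite S \<and> tens_id S (\<lambda>x y. - entry A x y) = (\<lambda>x y. - entry A x y)"
    using tens_id_binop[of "\<lambda>a b. - a" S "entry A" "entry A"] by (simp add: supp_def)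
  then show ?thesis unfolding uminus_locop_def by (subst Abs_locop_inverse) auto
qed

lemma entry_minus: "entry (A - B) x y = entry A x y - entry B x y"
  by (simp add: minus_locop_def entry_plus entry_uminus)

lemma entry_times: "entry (A * B) = mult_entry A B"
proof -
  obtain S where "supp S A" "supp S B" using supp_common2 by blast
  then have "finite S \<and> tens_id S (mult_entry A B) = mult_entry A B"
    by (simp add: tens_id_mult_entry supp_finite)
  then show ?thesis unfolding times_locop_def by (subst Abs_locop_inverse) auto
qed

lemma entry_mult: "supp S A \<Longrightarrow> entry (A * B) x y = (\<Sum>z\<in>fib S x. entry A x z * entry B z y)"
  by (simp add: entry_times mult_entry_fib)

lemma supp_mult: "supp S A \<Longrightarrow> supp S B \<Longrightarrow> supp S (A * B)"
  using tens_id_mult_entry by (simp add: supp_def entry_times)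

instance
proof
  fix A B C :: locop
  show "A + B + C = A + (B + C)" by (rule locop_eqI) (simp add: entry_plus)
  show "A + B = B + A" by (rule locop_eqI) (simp add: entry_plus)
  show "0 + A = A" by (rule locop_eqI) (simp add: entry_plus entry_0)
  show "- A + A = 0" by (rule locop_eqI) (simp add: entry_plus entry_0 entry_uminus)
  show "A - B = A + - B" by (simp add: minus_locop_def)
  have "entry (0::locop) {} {} \<noteq> entry 1 {} {}" by (simp add: entry_0 entry_1 op_one_def)
  then show "(0::locop) \<noteq> 1" by metis
  obtain S where S: "supp S A" "supp S B" "supp S C" using supp_common3 by blast
  note fin = supp_finite[OF S(1)]
  have one: "supp S 1" using fin by (simp add: supp_def entry_1 tens_id_op_one)
  show "1 * A = A"
  proof (rule locop_eqI)
    fix x y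
    have "entry (1 * A) x y = (\<Sum>z\<in>fib S x. if z = x then entry A z y else 0)"
      unfolding entry_mult[OF one] by (rule sum.cong) (auto simp: entry_1 op_one_def)
    then show "entry (1 * A) x y = entry A x y"
      using fin by (simp add: fib_self)
  qed
  show "A * 1 = A"
  proof (rule locop_eqI)
    fix x y
    have "entry (A * 1) x y = (\<Sum>z\<in>fib S x. if z = y then entry A x z else 0)"
      unfolding entry_mult[OF S(1)] by (rule sum.cong) (auto simp: entry_1 op_one_def)
    then show "entry (A * 1) x y = entry A x y"
      using fin entry_nz[OF S(1), of x y] by auto
  qed
  show "(A + B) * C = A * C + B * C"
  proof (rule locop_eqI)
    fix x y
    have AB: "supp S (A + B)"
      using S tens_id_binop[of "(+)" S "entry A" "entry B"]
      by (simp add: supp_def entry_plus[abs_def])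
    show "entry ((A + B) * C) x y = entry (A * C + B * C) x y"
      by (simp add: entry_mult[OF AB] entry_mult[OF S(1)] entry_mult[OF S(2)] entry_plus
          distrib_right sum.distrib)
  qed
  show "A * (B + C) = A * B + A * C"
    by (rule locop_eqI) (simp add: entry_mult[OF S(1)] entry_plus distrib_left sum.distrib)
  show "A * B * C = A * (B * C)"
  proof (rule locop_eqI)
    fix x y
    have "entry (A * B * C) x y =
        (\<Sum>z\<in>fib S x. \<Sum>w\<in>fib S x. entry A x w * entry B w z * entry C z y)"
      by (simp add: entry_mult[OF supp_mult[OF S(1,2)]] entry_mult[OF S(1)] sum_distrib_right)
    \<comment> \<open>All states reachable from \<open>x\<close> have the same fibre as
      \<open>x\<close>, so the two ranges of summation are independent.\<close>
    also have "\<dots> = (\<Sum>w\<in>fib S x. \<Sum>z\<in>fib S w. entry A x w * entry B w z * entry C z y)"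
      by (subst sum.swap) (auto intro!: sum.cong simp: fib_cong)
    also have "\<dots> = entry (A * (B * C)) x y"
      by (simp add: entry_mult[OF S(1)] entry_mult[OF S(2)] sum_distrib_left mult.assoc)
    finally show "entry (A * B * C) x y = entry (A * (B * C)) x y" .
  qed
qed

end

lemma supp_0: "finite S \<Longrightarrow> supp S 0"
  by (rule suppI) (auto simp: entry_0)

lemma supp_1: "finite S \<Longrightarrow> supp S 1"
  by (simp add: supp_def entry_1 tens_id_op_one)

lemma supp_plus: "supp S A \<Longrightarrow> supp S B \<Longrightarrow> supp S (A + B)"
  using tens_id_binop[of "(+)" S "entry A" "entry B"] by (simp add: supp_def entry_plus[abs_def])

lemma supp_sum: "finite S \<Longrightarrow> (\<And>i. i \<in> I \<Longrightarrow> supp S (A i)) \<Longrightarrow> supp S (sum A I)"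
  by (induction I rule: infinite_finite_induct) (auto intro: supp_0 supp_plus)

lemma supp_power: "supp S A \<Longrightarrow> supp S (A ^ n)"
  by (induction n) (auto intro: supp_1 supp_mult dest: supp_finite)

lemma supp_prod_list: "finite S \<Longrightarrow> (\<And>A. A \<in> set As \<Longrightarrow> supp S A) \<Longrightarrow> supp S (prod_list As)"
  by (induction As) (auto intro: supp_1 supp_mult)

lemma entry_sum: "entry (sum A I) x y = (\<Sum>i\<in>I. entry (A i) x y)"
  by (induction I rule: infinite_finite_induct) (auto simp: entry_0 entry_plus)

lemma entry_mult_subset:
  "supp S A \<Longrightarrow> x \<subseteq> S \<Longrightarrow> entry (A * B) x y = (\<Sum>z\<in>Pow S. entry A x z * entry B z y)"
  by (simp add: entry_mult fib_subset)

section \<open>Adjoints and complex multiples\<close>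

definition adj :: "locop \<Rightarrow> locop" where
  "adj A = Abs_locop (op_adj (entry A))"

lemma entry_adj: "entry (adj A) x y = cnj (entry A y x)"
proof -
  obtain S where "supp S A" using supp_exists by blast
  then have "finite S \<and> tens_id S (op_adj (entry A)) = op_adj (entry A)"
    by (simp add: supp_def tens_id_op_adj)
  then show ?thesis unfolding adj_def by (subst Abs_locop_inverse) (auto simp: op_adj_def)
qed

lemma supp_adj: "supp S A \<Longrightarrow> supp S (adj A)"
proof -
  have "entry (adj A) = op_adj (entry A)" by (intro ext) (simp add: entry_adj op_adj_def)
  then show "supp S A \<Longrightarrow> supp S (adj A)" by (simp add: supp_def tens_id_op_adj)
qed

lemma adj_adj [simp]: "adj (adj A) = A"
  by (rule locop_eqI) (simp add: entry_adj)

lemma adj_1 [simp]: "adj 1 = 1"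
  by (rule locop_eqI) (simp add: entry_adj entry_1 op_one_def)

lemma adj_sum: "adj (sum A I) = (\<Sum>i\<in>I. adj (A i))"
  by (rule locop_eqI) (simp add: entry_adj entry_sum)

lemma adj_mult: "adj (A * B) = adj B * adj A"
proof -
  obtain S where S: "supp S A" "supp S B" using supp_common2 by blast
  show ?thesis
  proof (rule locop_eqI_supp[of S])
    fix x y assume "x \<subseteq> S" "y \<subseteq> S"
    then show "entry (adj (A * B)) x y = entry (adj B * adj A) x y"
      by (simp add: entry_adj entry_mult_subset[OF S(1)] entry_mult_subset[OF supp_adj[OF S(2)]] mult.commute)
  qed (auto intro: S supp_adj supp_mult)
qed

lemma adj_power: "adj (A ^ n) = adj A ^ n"
  by (induction n) (auto simp: adj_mult power_commutes)

definition cscale :: "complex \<Rightarrow> locop \<Rightarrow> locop" where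
  "cscale c A = Abs_locop (\<lambda>x y. c * entry A x y)"

lemma tens_id_cscale: "tens_id S (\<lambda>x y. c * a x y) = (\<lambda>x y. c * tens_id S a x y)"
  by (intro ext) (auto simp: tens_id_def)

lemma entry_cscale: "entry (cscale c A) x y = c * entry A x y"
proof -
  obtain S where "supp S A" using supp_exists by blast
  then have "finite S \<and> tens_id S (\<lambda>x y. c * entry A x y) = (\<lambda>x y. c * entry A x y)"
    by (simp add: supp_def tens_id_cscale)
  then show ?thesis unfolding cscale_def by (subst Abs_locop_inverse) auto
qed

lemma supp_cscale: "supp S A \<Longrightarrow> supp S (cscale c A)"
  by (simp add: supp_def tens_id_cscale entry_cscale[abs_def])

lemma cscale_mult_left: "cscale c A * B = cscale c (A * B)"
proof -
  obtain S where S: "supp S A" using supp_exists by blast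
  show ?thesis
    by (rule locop_eqI)
      (simp add: entry_mult[OF S] entry_mult[OF supp_cscale[OF S]] entry_cscale sum_distrib_left mult.assoc)
qed

lemma cscale_mult_right: "A * cscale c B = cscale c (A * B)"
proof -
  obtain S where S: "supp S A" using supp_exists by blast
  show ?thesis
    by (rule locop_eqI)
      (simp add: entry_mult[OF S] entry_cscale sum_distrib_left mult.left_commute)
qed

lemma adj_cscale: "adj (cscale c A) = cscale (cnj c) (adj A)"
  by (rule locop_eqI) (simp add: entry_adj entry_cscale)

section \<open>Passage from matrices to the algebra\<close>

lemma lift_op_mult: "finite S \<Longrightarrow> lift S (op_mult S A B) = lift S A * lift S B"
  by (rule locop_eqI_supp[of S])
    (auto intro!: supp_lift supp_mult simp: entry_mult_subset[OF supp_lift] op_mult_def)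

lemma lift_op_one: "finite S \<Longrightarrow> lift S op_one = 1"
  by (rule locop_eqI) (simp add: entry_lift tens_id_op_one entry_1)

lemma lift_op_adj: "finite S \<Longrightarrow> lift S (op_adj A) = adj (lift S A)"
  by (rule locop_eqI) (simp add: entry_lift tens_id_op_adj entry_adj, simp add: op_adj_def)

text \<open>For each finite \<open>S\<close> the lift respects products, unit and adjoints, so the
  operator products that define circuits, evolutions and costs all become products in one
  ring.\<close>

lemma lift_op_prod: "finite S \<Longrightarrow> lift S (op_prod S As) = prod_list (map (lift S) As)"
  by (induction As) (auto simp: op_prod_def lift_op_one lift_op_mult)

lemma lift_cscale: "finite S \<Longrightarrow> lift S (\<lambda>x y. c * A x y) = cscale c (lift S A)"
  by (rule locop_eqI) (simp add: entry_lift tens_id_cscale entry_cscale)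

lemma lift_minus: "finite S \<Longrightarrow> lift S (\<lambda>x y. A x y - B x y) = lift S A - lift S B"
  by (rule locop_eqI) (simp add: entry_lift entry_minus tens_id_def)

lemma lift_sum: "finite S \<Longrightarrow> lift S (\<lambda>x y. \<Sum>i\<in>I. A i x y) = (\<Sum>i\<in>I. lift S (A i))"
  by (rule locop_eqI) (simp add: entry_lift entry_sum tens_id_def)

text \<open>Only one intermediate state survives: \<open>A\<close> changes nothing off
  \<open>X\<close> and \<open>B\<close> changes nothing on \<open>X\<close>, so it agrees with
  \<open>x\<close> off \<open>X\<close> and with \<open>y\<close> on \<open>X\<close>. The resulting
  formula is symmetric in the two factors, which yields commutation.\<close>

lemma supp_disjoint_entry:
  assumes A: "supp X A" and B: "supp Y B" and XY: "X \<inter> Y = {}"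
  shows "entry (A * B) x y = (if x - (X \<union> Y) = y - (X \<union> Y)
    then entry A (x \<inter> X) (y \<inter> X) * entry B (x \<inter> Y) (y \<inter> Y) else 0)"
proof -
  let ?z = "(x - X) \<union> (y \<inter> X)"
  have fin: "finite X" using A by (rule supp_finite)
  have "entry (A * B) x y = (\<Sum>z\<in>fib X x. if z = ?z then entry A x z * entry B z y else 0)"
    unfolding entry_mult[OF A]
  proof (rule sum.cong)
    fix z assume z: "z \<in> fib X x"
    have "z = ?z" if "z - Y = y - Y"
    proof -
      have "z \<inter> X = (z - Y) \<inter> X" "y \<inter> X = (y - Y) \<inter> X" using XY by auto
      then have "z \<inter> X = y \<inter> X" using that by simp
      moreover have "z = (z - X) \<union> (z \<inter> X)" by auto
      ultimately show ?thesis using z by (simp add: fib_def)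
    qed
    then show "entry A x z * entry B z y = (if z = ?z then entry A x z * entry B z y else 0)"
      using entry_nz[OF B, of z y] unfolding fib_def
      by (metis (mono_tags, lifting) mem_Collect_eq mult_zero_right)
  qed simp
  also have "\<dots> = entry A x ?z * entry B ?z y"
    using fin by (simp, auto simp: fib_def)
  also have "entry A x ?z = entry A (x \<inter> X) (y \<inter> X)"
  proof -
    have "x - X = ?z - X" "?z \<inter> X = y \<inter> X" by auto
    then show ?thesis by (simp add: entry_supp[OF A, of x ?z])
  qed
  also have "entry B ?z y = (if x - (X \<union> Y) = y - (X \<union> Y) then entry B (x \<inter> Y) (y \<inter> Y) else 0)"
  proof -
    have "?z - Y = y - Y \<longleftrightarrow> x - (X \<union> Y) = y - (X \<union> Y)"
    proof
      have "x - (X \<union> Y) = (?z - Y) - X" by auto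
      also assume "?z - Y = y - Y"
      finally show "x - (X \<union> Y) = y - (X \<union> Y)" by auto
    next
      have "?z - Y = (x - (X \<union> Y)) \<union> (y \<inter> X - Y)" by auto
      also assume "x - (X \<union> Y) = y - (X \<union> Y)"
      finally show "?z - Y = y - Y" by auto
    qed
    moreover have "?z \<inter> Y = x \<inter> Y" using XY by auto
    ultimately show ?thesis by (simp add: entry_supp[OF B, of ?z y])
  qed
  finally show ?thesis by simp
qed

lemma supp_disjoint_commute:
  assumes "supp X A" "supp Y B" "X \<inter> Y = {}"
  shows "A * B = B * A"
proof (rule locop_eqI)
  fix x y
  have "Y \<inter> X = {}" using assms(3) by blast
  then show "entry (A * B) x y = entry (B * A) x y"
    unfolding supp_disjoint_entry[OF assms] supp_disjoint_entry[OF assms(2,1) \<open>Y \<inter> X = {}\<close>]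
    by (simp add: Un_commute[of Y X])
qed

section \<open>Exponentials and Duhamel's formula\<close>

text \<open>The series is taken entry by entry. That the result is again a local operator holds
  termwise, before convergence is known.\<close>

definition lexp :: "locop \<Rightarrow> locop" where
  "lexp A = Abs_locop (\<lambda>x y. \<Sum>n. entry (A ^ n) x y / fact n)"

lemma tens_id_lexp:
  assumes "supp S A"
  shows "tens_id S (\<lambda>x y. \<Sum>n. entry (A ^ n) x y / fact n) = (\<lambda>x y. \<Sum>n. entry (A ^ n) x y / fact n)"
proof (intro ext)
  fix x y
  show "tens_id S (\<lambda>x y. \<Sum>n. entry (A ^ n) x y / fact n) x y = (\<Sum>n. entry (A ^ n) x y / fact n)"
    using entry_supp[OF supp_power[OF assms], of _ x y] by (simp add: tens_id_def)
qed

lemma entry_lexp: "entry (lexp A) x y = (\<Sum>n. entry (A ^ n) x y / fact n)"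
proof -
  obtain S where "supp S A" using supp_exists by blast
  then have "finite S \<and> tens_id S (\<lambda>x y. \<Sum>n. entry (A ^ n) x y / fact n) =
      (\<lambda>x y. \<Sum>n. entry (A ^ n) x y / fact n)"
    by (simp add: tens_id_lexp supp_finite)
  then show ?thesis unfolding lexp_def by (subst Abs_locop_inverse) auto
qed

lemma supp_lexp: "supp S A \<Longrightarrow> supp S (lexp A)"
  using tens_id_lexp[of S A] by (simp add: supp_def entry_lexp[abs_def])

lemma lift_op_exp:
  assumes "finite S"
  shows "lift S (op_exp S A) = lexp (lift S A)"
proof (rule locop_eqI_supp[of S])
  fix x y assume xy: "x \<subseteq> S" "y \<subseteq> S"
  have "op_prod S (replicate n A) x y = entry (lift S A ^ n) x y" for n
    using lift_op_prod[OF assms, of "replicate n A"] entry_lift_subset[OF assms xy, of "op_prod S (replicate n A)"]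
    by (simp add: prod_list_replicate)
  then show "entry (lift S (op_exp S A)) x y = entry (lexp (lift S A)) x y"
    using assms xy by (simp add: entry_lexp op_exp_def)
qed (auto intro: supp_lift supp_lexp assms)

text \<open>Every entry vanishes or repeats one of the finitely many with indices in
  \<open>Pow S\<close>; the inserted 0 in the maximum covers the first case.\<close>

lemma entry_bounded:
  obtains b where "\<And>x y. cmod (entry A x y) \<le> b"
proof -
  obtain S where S: "supp S A" using supp_exists by blast
  have fin: "finite ((\<lambda>(x, y). cmod (entry A x y)) ` (Pow S \<times> Pow S))"
    using supp_finite[OF S] by simp
  have "cmod (entry A x y) \<le> Max (insert 0 ((\<lambda>(x, y). cmod (entry A x y)) ` (Pow S \<times> Pow S)))" for x y
    unfolding entry_supp[OF S, of x y] using fin by (auto intro!: Max_ge)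
  then show ?thesis using that by blast
qed

text \<open>A row of \<open>A\<close> is supported on one fibre of \<open>card (Pow S)\<close>
  states, so each further factor costs at most \<open>card (Pow S) * b\<close>.\<close>

lemma entry_power_bounded:
  obtains K where "\<And>n x y. cmod (entry (A ^ n) x y) \<le> K ^ n"
proof -
  obtain S where S: "supp S A" using supp_exists by blast
  obtain b where b: "\<And>x y. cmod (entry A x y) \<le> b" using entry_bounded by blast
  have b0: "0 \<le> b" using b[of "{}" "{}"] norm_ge_zero order_trans by blast
  let ?K = "card (Pow S) * b"
  have "cmod (entry (A ^ n) x y) \<le> ?K ^ n" for n x y
  proof (induction n arbitrary: x y)
    case 0
    then show ?case by (simp add: entry_1 op_one_def)
  next
    case (Suc n)
    have "cmod (entry (A ^ Suc n) x y) \<le> (\<Sum>z\<in>fib S x. cmod (entry A x z * entry (A ^ n) z y))"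
      by (simp add: entry_mult[OF S] norm_sum)
    also have "\<dots> \<le> (\<Sum>z\<in>fib S x. b * ?K ^ n)"
      using b b0 Suc.IH by (intro sum_mono) (auto simp: norm_mult intro!: mult_mono)
    also have "\<dots> = ?K ^ Suc n"
      by (simp add: card_fib)
    finally show ?case .
  qed
  then show ?thesis using that by blast
qed

text \<open>The value \<open>t = 1\<close> gives the exponential itself; arbitrary \<open>t\<close>
  allows termwise differentiation of the power series in time.\<close>

lemma summable_entry_power:
  "summable (\<lambda>n. entry (A ^ n) x y / fact n * t ^ n)"
proof -
  obtain K where K: "\<And>n x y. cmod (entry (A ^ n) x y) \<le> K ^ n" using entry_power_bounded by blast
  show ?thesis
  proof (rule summable_comparison_test')
    show "summable (\<lambda>n. inverse (fact n) * (K * cmod t) ^ n)"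
      by (rule summable_exp)
    show "cmod (entry (A ^ n) x y / fact n * t ^ n) \<le> inverse (fact n) * (K * cmod t) ^ n" for n
    proof -
      have "cmod (entry (A ^ n) x y / fact n * t ^ n) =
          cmod (entry (A ^ n) x y) * (inverse (fact n) * cmod t ^ n)"
        by (simp add: norm_mult norm_divide norm_power norm_fact divide_inverse norm_inverse)
      also have "\<dots> \<le> K ^ n * (inverse (fact n) * cmod t ^ n)"
        by (intro mult_right_mono K) simp
      finally show ?thesis by (simp add: power_mult_distrib ac_simps)
    qed
  qed
qed

lemma sums_lexp: "(\<lambda>n. entry (A ^ n) x y / fact n) sums entry (lexp A) x y"
  using summable_sums[OF summable_entry_power[of A x y 1]] by (simp add: entry_lexp)

lemma sums_mult_lexp: "(\<lambda>n. entry (B * A ^ n) x y / fact n) sums entry (B * lexp A) x y"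
proof -
  obtain S where S: "supp S B" using supp_exists by blast
  have "(\<lambda>n. \<Sum>z\<in>fib S x. entry B x z * (entry (A ^ n) z y / fact n)) sums
      (\<Sum>z\<in>fib S x. entry B x z * entry (lexp A) z y)"
    by (intro sums_sum sums_mult sums_lexp)
  then show ?thesis by (simp add: entry_mult[OF S] sum_divide_distrib)
qed

lemma sums_lexp_mult: "(\<lambda>n. entry (A ^ n * B) x y / fact n) sums entry (lexp A * B) x y"
proof -
  obtain S where S: "supp S A" using supp_exists by blast
  have "(\<lambda>n. \<Sum>z\<in>fib S x. entry (A ^ n) x z / fact n * entry B z y) sums
      (\<Sum>z\<in>fib S x. entry (lexp A) x z * entry B z y)"
    by (intro sums_sum sums_mult2 sums_lexp)
  then show ?thesis
    by (simp add: entry_mult[OF supp_power[OF S]] entry_mult[OF supp_lexp[OF S]] sum_divide_distrib)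
qed

lemma lexp_commute:
  assumes "A * B = B * A"
  shows "B * lexp A = lexp A * B"
proof (rule locop_eqI)
  fix x y
  have "B * A ^ n = A ^ n * B" for n
    using assms by (simp add: power_commuting_commutes)
  then show "entry (B * lexp A) x y = entry (lexp A * B) x y"
    using sums_unique2[OF sums_mult_lexp[of B A x y]] sums_lexp_mult[of A B x y] by simp
qed

lemma adj_lexp: "adj (lexp A) = lexp (adj A)"
proof (rule locop_eqI)
  fix x y
  have "(\<lambda>n. entry (adj A ^ n) x y / fact n) sums cnj (entry (lexp A) y x)"
    using sums_lexp[of A y x, THEN sums_cnj[THEN iffD2]]
    by (simp add: adj_power[symmetric] entry_adj)
  then show "entry (adj (lexp A)) x y = entry (lexp (adj A)) x y"
    using sums_unique2[OF sums_lexp[of "adj A" x y]] by (simp add: entry_adj)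
qed

section \<open>One-parameter groups and their derivatives\<close>

definition flow :: "locop \<Rightarrow> real \<Rightarrow> locop" where
  "flow A s = lexp (cscale (of_real s) A)"

lemma cscale_power: "cscale c A ^ n = cscale (c ^ n) (A ^ n)"
proof (induction n)
  case 0
  then show ?case by (intro locop_eqI) (simp add: entry_cscale)
next
  case (Suc n)
  then show ?case
    by (intro locop_eqI) (simp add: cscale_mult_left cscale_mult_right entry_cscale)
qed

lemma supp_flow: "supp S A \<Longrightarrow> supp S (flow A s)"
  by (simp add: flow_def supp_lexp supp_cscale)

lemma entry_flow: "entry (flow A s) x y = (\<Sum>n. entry (A ^ n) x y / fact n * of_real s ^ n)"
  by (simp add: flow_def entry_lexp cscale_power entry_cscale ac_simps)

lemma flow_0 [simp]: "flow A 0 = 1"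
proof (rule locop_eqI)
  show "entry (flow A 0) x y = entry 1 x y" for x y
    using powser_zero[of "\<lambda>n. entry (A ^ n) x y / fact n"] by (simp add: entry_flow)
qed

lemma flow_commute: "A * flow A s = flow A s * A"
  unfolding flow_def by (rule lexp_commute) (simp add: cscale_mult_left cscale_mult_right)

lemma adj_flow:
  assumes "adj A = - A"
  shows "adj (flow A s) = flow A (- s)"
proof -
  have "adj (cscale (of_real s) A) = cscale (of_real (- s)) A"
    by (rule locop_eqI) (simp add: adj_cscale assms entry_cscale entry_uminus)
  then show ?thesis by (simp add: flow_def adj_lexp)
qed

text \<open>Entrywise differentiability, so that no topology on \<^typ>\<open>locop\<close> is needed.\<close>

definition has_op_deriv :: "(real \<Rightarrow> locop) \<Rightarrow> locop \<Rightarrow> real \<Rightarrow> bool" where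
  "has_op_deriv F F' s \<longleftrightarrow>
     (\<forall>x y. ((\<lambda>t. entry (F t) x y) has_vector_derivative entry F' x y) (at s))"

lemma has_op_deriv_const: "has_op_deriv (\<lambda>t. A) 0 s"
  by (simp add: has_op_deriv_def entry_0)

text \<open>The support of \<open>F t\<close> is fixed uniformly in \<open>t\<close>, so each entry
  of the product is a sum over one fixed fibre and the scalar product rule applies termwise.\<close>

lemma has_op_deriv_mult:
  assumes "has_op_deriv F F' s" "has_op_deriv G G' s" and S: "\<And>t. supp S (F t)" "supp S F'"
  shows "has_op_deriv (\<lambda>t. F t * G t) (F' * G s + F s * G') s"
  unfolding has_op_deriv_def
proof (intro allI)
  fix x y
  have "((\<lambda>t. \<Sum>z\<in>fib S x. entry (F t) x z * entry (G t) z y) has_vector_derivative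
      (\<Sum>z\<in>fib S x. entry (F s) x z * entry G' z y + entry F' x z * entry (G s) z y)) (at s)"
    using assms(1,2) unfolding has_op_deriv_def
    by (intro has_vector_derivative_sum has_vector_derivative_mult) auto
  then show "((\<lambda>t. entry (F t * G t) x y) has_vector_derivative entry (F' * G s + F s * G') x y) (at s)"
    by (simp add: entry_plus entry_mult[OF S(1)] entry_mult[OF S(2)] sum.distrib add.commute)
qed

lemma has_op_deriv_flip:
  assumes "has_op_deriv F F' (c - s)"
  shows "has_op_deriv (\<lambda>t. F (c - t)) (- F') s"
  unfolding has_op_deriv_def
proof (intro allI)
  fix x y
  have "((\<lambda>t. c - t) has_vector_derivative - 1) (at s)"
    by (auto intro!: derivative_eq_intros)
  moreover have "((\<lambda>t. entry (F t) x y) has_vector_derivative entry F' x y) (at (c - s))"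
    using assms by (simp add: has_op_deriv_def)
  ultimately show "((\<lambda>t. entry (F (c - t)) x y) has_vector_derivative entry (- F') x y) (at s)"
    using vector_diff_chain_at[of "\<lambda>t. c - t" "- 1" s "\<lambda>t. entry (F t) x y" "entry F' x y"]
    by (simp add: o_def entry_uminus)
qed

lemma has_op_deriv_flow: "has_op_deriv (flow A) (A * flow A s) s"
  unfolding has_op_deriv_def
proof (intro allI)
  fix x y
  let ?c = "\<lambda>n. entry (A ^ n) x y / fact n"
  have "((\<lambda>z. \<Sum>n. ?c n * z ^ n) has_field_derivative (\<Sum>n. diffs ?c n * of_real s ^ n)) (at (of_real s))"
    by (rule termdiffs_strong_converges_everywhere) (rule summable_entry_power)
  then have "((\<lambda>t. \<Sum>n. ?c n * of_real t ^ n) has_vector_derivative (\<Sum>n. diffs ?c n * of_real s ^ n)) (at s)"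
    by (rule has_vector_derivative_real_field)
  \<comment> \<open>\<open>diffs\<close> shifts the coefficients, and (n + 1) / (n + 1)! = 1 / n!
    leaves \<open>A\<close> times the n-th term of the exponential.\<close>
  moreover have "diffs ?c n * of_real s ^ n = entry (A * cscale (of_real s) A ^ n) x y / fact n" for n
    by (simp add: diffs_def cscale_power cscale_mult_right entry_cscale field_simps del: of_nat_Suc)
  then have "(\<Sum>n. diffs ?c n * of_real s ^ n) = entry (A * flow A s) x y"
    using sums_mult_lexp[of A "cscale (of_real s) A" x y] by (simp add: flow_def sums_iff)
  ultimately show "((\<lambda>t. entry (flow A t) x y) has_vector_derivative entry (A * flow A s) x y) (at s)"
    by (simp add: entry_flow)
qed

lemma supp_uminus: "supp S A \<Longrightarrow> supp S (- A)"
  using tens_id_binop[of "\<lambda>a b. - a" S "entry A" "entry A"] by (simp add: supp_def entry_uminus[abs_def])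

lemma has_op_deriv_flow_flip: "has_op_deriv (\<lambda>t. flow A (c - t)) (- (A * flow A (c - s))) s"
  by (rule has_op_deriv_flip) (rule has_op_deriv_flow)

text \<open>The product has derivative zero and equals 1 at time 0. Time is written
  \<open>0 - t\<close> to match the rule for reversed time.\<close>

lemma flow_inverse: "flow A s * flow A (- s) = 1"
proof (rule locop_eqI)
  fix x y
  obtain S where S: "supp S A" using supp_exists by blast
  have "has_op_deriv (\<lambda>t. flow A t * flow A (0 - t)) 0 t" for t
  proof -
    have "has_op_deriv (\<lambda>t. flow A t * flow A (0 - t))
        (A * flow A t * flow A (0 - t) + flow A t * - (A * flow A (0 - t))) t"
      by (intro has_op_deriv_mult[of _ _ _ _ _ S] has_op_deriv_flow has_op_deriv_flow_flip)
        (auto intro: S supp_flow supp_mult)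
    also have "A * flow A t * flow A (0 - t) + flow A t * - (A * flow A (0 - t)) = 0"
      by (simp add: flow_commute[of A t] mult.assoc)
    finally show ?thesis .
  qed
  then have "((\<lambda>t. entry (flow A t * flow A (- t)) x y) has_vector_derivative 0) (at t within UNIV)" for t
    by (simp add: has_op_deriv_def entry_0)
  then obtain c where "\<And>t. entry (flow A t * flow A (- t)) x y = c"
    using has_vector_derivative_zero_constant[of UNIV "\<lambda>t. entry (flow A t * flow A (- t)) x y"] by auto
  from this[of s] this[of 0] show "entry (flow A s * flow A (- s)) x y = entry 1 x y"
    by simp
qed

lemma flow_inverse': "flow A (- s) * flow A s = 1"
  using flow_inverse[of A "- s"] by simp

text \<open>Interpolation: \<open>F s\<close> evolves with \<open>G'\<close> for the remaining time
  \<open>\<tau> - s\<close> and then with \<open>G\<close> for time \<open>s\<close>, so its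
  endpoints are the two evolutions. Its derivative is a commutator of the \<open>G'\<close>-evolved
  \<open>A\<close> with \<open>G - G'\<close>, seen in the isometry \<open>flow G s * Q\<close>. The
  mean value inequality turns a bound \<open>M\<close> on it into \<open>M * \<tau>\<close>. Working
  with one expectation value keeps the function scalar.\<close>

lemma duhamel_bound:
  assumes \<tau>: "0 \<le> \<tau>" and supp: "supp T G" "supp T G'" "supp T A" "supp T Q"
    and G: "adj G = - G" and Q: "adj Q * Q = 1"
    and bound: "\<And>s R B. 0 \<le> s \<Longrightarrow> s \<le> \<tau> \<Longrightarrow> supp T R \<Longrightarrow> adj R * R = 1 \<Longrightarrow>
      B = flow G' (- s) * A * flow G' s \<Longrightarrow>
      cmod (entry (adj R * (B * (G - G') - (G - G') * B) * R) {} {}) \<le> M"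
  shows "cmod (entry (adj Q * (flow G (- \<tau>) * A * flow G \<tau> - flow G' (- \<tau>) * A * flow G' \<tau>) * Q) {} {})
    \<le> M * \<tau>"
proof -
  define B where "B s = flow G' (- (\<tau> - s)) * A * flow G' (\<tau> - s)" for s
  define F where "F s = adj Q * (flow G (0 - s) * B s * flow G s * Q)" for s
  define f where "f s = entry (F s) {} {}" for s
  have suppB: "supp T (B s)" for s
    unfolding B_def by (intro supp_mult supp_flow supp)
  have dB: "has_op_deriv B (G' * B s - B s * G') s" for s
  proof -
    have "has_op_deriv (\<lambda>t. flow G' (- (\<tau> - t))) (G' * flow G' (- (\<tau> - s))) s"
    proof -
      \<comment> \<open>Time is reversed twice, first about 0 and then about \<open>\<tau>\<close>,
        so the two signs cancel.\<close>
      have "has_op_deriv (\<lambda>t. flow G' (- t)) (- (G' * flow G' (- (\<tau> - s)))) (\<tau> - s)"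
        using has_op_deriv_flow_flip[of G' 0 "\<tau> - s"] by simp
      from has_op_deriv_flip[OF this] show ?thesis by simp
    qed
    then have "has_op_deriv B
       ((G' * flow G' (- (\<tau> - s)) * A + flow G' (- (\<tau> - s)) * 0) * flow G' (\<tau> - s) +
        flow G' (- (\<tau> - s)) * A * - (G' * flow G' (\<tau> - s))) s"
      unfolding B_def
      by (intro has_op_deriv_mult[of _ _ _ _ _ T] has_op_deriv_flow_flip has_op_deriv_const)
        (auto intro!: supp supp_flow supp_mult supp_plus supp_0 dest: supp_finite)
    moreover have "(G' * flow G' (- (\<tau> - s)) * A + flow G' (- (\<tau> - s)) * 0) * flow G' (\<tau> - s) +
        flow G' (- (\<tau> - s)) * A * - (G' * flow G' (\<tau> - s)) = G' * B s - B s * G'"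
      unfolding B_def flow_commute[of G' "\<tau> - s"] by (simp add: mult.assoc)
    ultimately show ?thesis by simp
  qed
  have dF: "has_op_deriv F (adj (flow G s * Q) * (B s * (G - G') - (G - G') * B s) * (flow G s * Q)) s" for s
  proof -
    have fin: "finite T" using supp(1) by (rule supp_finite)
    have "has_op_deriv F (0 * (flow G (0 - s) * B s * flow G s * Q) +
        adj Q * (((- (G * flow G (0 - s)) * B s + flow G (0 - s) * (G' * B s - B s * G')) * flow G s
          + flow G (0 - s) * B s * (G * flow G s)) * Q + flow G (0 - s) * B s * flow G s * 0)) s"
      unfolding F_def
      by (intro has_op_deriv_mult[of _ _ _ _ _ T] has_op_deriv_flow_flip has_op_deriv_flow has_op_deriv_const dB;
          simp add: fin supp suppB supp_flow supp_mult supp_plus supp_0 supp_adj supp_uminus diff_conv_add_uminus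
            del: add_uminus_conv_diff)
    \<comment> \<open>\<open>G\<close> commutes with its own flow, so it can be moved next to
      \<open>B s\<close>, where all terms combine into the commutator with
      \<open>G - G'\<close>.\<close>
    moreover have "0 * (flow G (0 - s) * B s * flow G s * Q) +
        adj Q * (((- (G * flow G (0 - s)) * B s + flow G (0 - s) * (G' * B s - B s * G')) * flow G s
          + flow G (0 - s) * B s * (G * flow G s)) * Q + flow G (0 - s) * B s * flow G s * 0)
       = adj (flow G s * Q) * (B s * (G - G') - (G - G') * B s) * (flow G s * Q)"
      using flow_commute[of G "0 - s"] by (simp add: adj_mult adj_flow[OF G] algebra_simps)
    ultimately show ?thesis by simp
  qed
  have df: "(f has_vector_derivative
      entry (adj (flow G s * Q) * (B s * (G - G') - (G - G') * B s) * (flow G s * Q)) {} {}) (at s)" for s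
    using dF[of s] unfolding f_def has_op_deriv_def by blast
  have "norm (f \<tau> - f 0) \<le> M * norm (\<tau> - 0)"
  proof (rule differentiable_bound[where S = "{0..\<tau>}"])
    fix s assume s: "s \<in> {0..\<tau>}"
    let ?D = "entry (adj (flow G s * Q) * (B s * (G - G') - (G - G') * B s) * (flow G s * Q)) {} {}"
    show "(f has_derivative (\<lambda>t. t *\<^sub>R ?D)) (at s within {0..\<tau>})"
      using df[of s] has_derivative_at_withinI unfolding has_vector_derivative_def by blast
    have iso: "adj (flow G s * Q) * (flow G s * Q) = 1"
    proof -
      have "adj (flow G s * Q) * (flow G s * Q) = adj Q * (flow G (- s) * flow G s) * Q"
        by (simp add: adj_mult adj_flow[OF G] mult.assoc)
      then show ?thesis by (simp add: flow_inverse' Q)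
    qed
    have "cmod ?D \<le> M"
      using s by (intro bound[of "\<tau> - s"] iso supp_mult supp_flow supp) (auto simp: B_def)
    then show "onorm (\<lambda>t. t *\<^sub>R ?D) \<le> M"
      by (subst onorm_scaleR_left) (auto simp: onorm_id)
  qed (use \<tau> in auto)
  moreover have "f \<tau> - f 0 =
      entry (adj Q * (flow G (- \<tau>) * A * flow G \<tau> - flow G' (- \<tau>) * A * flow G' \<tau>) * Q) {} {}"
    unfolding f_def entry_minus[symmetric] F_def B_def by (simp add: algebra_simps)
  ultimately show ?thesis using \<tau> by simp
qed

section \<open>Locality of the time evolution\<close>

lemma vec_norm_nonneg [simp]: "0 \<le> vec_norm S \<psi>"
  by (simp add: vec_norm_def)

lemma braket_self: "braket S \<psi> \<psi> = of_real ((vec_norm S \<psi>)\<^sup>2)"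
proof -
  have "(vec_norm S \<psi>)\<^sup>2 = (\<Sum>x\<in>Pow S. (cmod (\<psi> x))\<^sup>2)"
    unfolding vec_norm_def L2_set_def by (simp add: sum_nonneg)
  moreover have "braket S \<psi> \<psi> = (\<Sum>x\<in>Pow S. of_real ((cmod (\<psi> x))\<^sup>2))"
    unfolding braket_def by (rule sum.cong) (auto simp: complex_norm_square mult.commute simp del: of_real_power)
  ultimately show ?thesis by simp
qed

lemma cmod_braket_le: "cmod (braket S \<phi> \<psi>) \<le> vec_norm S \<phi> * vec_norm S \<psi>"
proof -
  have "cmod (braket S \<phi> \<psi>) \<le> (\<Sum>x\<in>Pow S. cmod (cnj (\<phi> x) * \<psi> x))"
    unfolding braket_def by (rule norm_sum)
  also have "\<dots> = (\<Sum>x\<in>Pow S. \<bar>cmod (\<phi> x)\<bar> * \<bar>cmod (\<psi> x)\<bar>)"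
    by (simp add: norm_mult)
  also have "\<dots> \<le> vec_norm S \<phi> * vec_norm S \<psi>"
    unfolding vec_norm_def by (rule L2_set_mult_ineq)
  finally show ?thesis .
qed

text \<open>The sum of all matrix entries is a crude bound, but it suffices to make the supremum in
  \<open>opnorm\<close> meaningful.\<close>

lemma opnorm_bdd_above:
  assumes "finite S"
  shows "bdd_above ((\<lambda>\<psi>. vec_norm S (op_apply S A \<psi>)) ` {\<psi>. vec_norm S \<psi> \<le> 1})"
proof (rule bdd_aboveI2)
  fix \<psi> assume "\<psi> \<in> {\<psi>. vec_norm S \<psi> \<le> 1}"
  then have le1: "cmod (\<psi> y) \<le> 1" if "y \<in> Pow S" for y
    using member_le_L2_set[of "Pow S" y "\<lambda>x. cmod (\<psi> x)"] that assms
    by (simp add: vec_norm_def)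
  have "vec_norm S (op_apply S A \<psi>) \<le> (\<Sum>x\<in>Pow S. cmod (op_apply S A \<psi> x))"
    unfolding vec_norm_def by (rule L2_set_le_sum) simp
  also have "\<dots> \<le> (\<Sum>x\<in>Pow S. \<Sum>y\<in>Pow S. cmod (A x y))"
  proof (rule sum_mono)
    fix x
    have "cmod (op_apply S A \<psi> x) \<le> (\<Sum>y\<in>Pow S. cmod (A x y * \<psi> y))"
      unfolding op_apply_def by (rule norm_sum)
    also have "\<dots> \<le> (\<Sum>y\<in>Pow S. cmod (A x y))"
      using le1 by (intro sum_mono) (auto simp: norm_mult intro: mult_left_le)
    finally show "cmod (op_apply S A \<psi> x) \<le> (\<Sum>y\<in>Pow S. cmod (A x y))" .
  qed
  finally show "vec_norm S (op_apply S A \<psi>) \<le> (\<Sum>x\<in>Pow S. \<Sum>y\<in>Pow S. cmod (A x y))" .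
qed

lemma vec_norm_apply_le:
  "finite S \<Longrightarrow> vec_norm S \<psi> \<le> 1 \<Longrightarrow> vec_norm S (op_apply S A \<psi>) \<le> opnorm S A"
  unfolding opnorm_def by (rule cSUP_upper) (auto intro: opnorm_bdd_above)

lemma vec_norm_zero [simp]: "vec_norm S (\<lambda>x. 0) = 0"
  by (simp add: vec_norm_def L2_set_def)

lemma opnorm_le:
  assumes "\<And>\<psi>. vec_norm S \<psi> \<le> 1 \<Longrightarrow> vec_norm S (op_apply S A \<psi>) \<le> c"
  shows "opnorm S A \<le> c"
proof -
  have "(\<lambda>x. 0) \<in> {\<psi>. vec_norm S \<psi> \<le> 1}" by simp
  then show ?thesis
    unfolding opnorm_def by (intro cSUP_least) (use assms in blast)+
qed

lemma opnorm_nonneg: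
  assumes "finite S"
  shows "0 \<le> opnorm S A"
  using order_trans[OF vec_norm_nonneg vec_norm_apply_le[OF assms, of "\<lambda>x. 0" A]] by simp

lemma opnorm_scale_le:
  assumes "finite S"
  shows "opnorm S (\<lambda>x y. c * A x y) \<le> cmod c * opnorm S A"
proof (rule opnorm_le)
  fix \<psi> assume "vec_norm S \<psi> \<le> 1"
  have "vec_norm S (op_apply S (\<lambda>x y. c * A x y) \<psi>) = cmod c * vec_norm S (op_apply S A \<psi>)"
  proof -
    have "op_apply S (\<lambda>x y. c * A x y) \<psi> = (\<lambda>x. c * op_apply S A \<psi> x)"
      by (simp add: op_apply_def sum_distrib_left mult.assoc)
    then show ?thesis by (simp add: vec_norm_def norm_mult L2_set_right_distrib)
  qed
  also have "\<dots> \<le> cmod c * opnorm S A"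
    using \<open>vec_norm S \<psi> \<le> 1\<close> assms by (intro mult_left_mono vec_norm_apply_le) auto
  finally show "vec_norm S (op_apply S (\<lambda>x y. c * A x y) \<psi>) \<le> cmod c * opnorm S A" .
qed

text \<open>By the hypothesis the squared norm of the image of \<psi> equals its inner product with
  \<psi>. Cauchy-Schwarz bounds this by \<open>vec_norm T \<psi> * ?n\<close>, and one factor
  \<open>?n\<close> cancels.\<close>

lemma opnorm_projection_le:
  assumes T: "finite T" and P: "adj (lift T M) * lift T M = lift T M"
  shows "opnorm T M \<le> 1"
proof (rule opnorm_le)
  fix \<psi> assume \<psi>: "vec_norm T \<psi> \<le> 1"
  let ?n = "vec_norm T (op_apply T M \<psi>)"
  have M: "(\<Sum>x\<in>Pow T. cnj (M x y) * M x z) = M y z" if "y \<subseteq> T" "z \<subseteq> T" for y z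
  proof -
    have "M y z = entry (adj (lift T M) * lift T M) y z"
      using P T that by simp
    also have "\<dots> = (\<Sum>x\<in>Pow T. cnj (M x y) * M x z)"
      using T that by (simp add: entry_mult_subset[OF supp_adj[OF supp_lift]] entry_adj)
    finally show ?thesis by simp
  qed
  have "of_real (?n\<^sup>2) = braket T (op_apply T M \<psi>) (op_apply T M \<psi>)"
    by (rule braket_self[symmetric])
  also have "\<dots> = (\<Sum>x\<in>Pow T. \<Sum>y\<in>Pow T. \<Sum>z\<in>Pow T. cnj (\<psi> y) * (cnj (M x y) * M x z) * \<psi> z)"
    by (simp add: braket_def op_apply_def sum_distrib_left sum_distrib_right ac_simps)
  also have "\<dots> = (\<Sum>y\<in>Pow T. \<Sum>x\<in>Pow T. \<Sum>z\<in>Pow T. cnj (\<psi> y) * (cnj (M x y) * M x z) * \<psi> z)"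
    by (rule sum.swap)
  also have "\<dots> = (\<Sum>y\<in>Pow T. \<Sum>z\<in>Pow T. \<Sum>x\<in>Pow T. cnj (\<psi> y) * (cnj (M x y) * M x z) * \<psi> z)"
    by (intro sum.cong refl sum.swap)
  also have "\<dots> = (\<Sum>y\<in>Pow T. \<Sum>z\<in>Pow T. cnj (\<psi> y) * M y z * \<psi> z)"
    by (intro sum.cong refl) (simp add: sum_distrib_left[symmetric] sum_distrib_right[symmetric] M)
  also have "\<dots> = braket T \<psi> (op_apply T M \<psi>)"
    by (simp add: braket_def op_apply_def sum_distrib_left mult.assoc)
  finally have "?n\<^sup>2 = cmod (braket T \<psi> (op_apply T M \<psi>))"
    by (metis norm_of_real abs_power2)
  also have "\<dots> \<le> vec_norm T \<psi> * ?n"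
    by (rule cmod_braket_le)
  also have "\<dots> \<le> 1 * ?n"
    using \<psi> by (intro mult_right_mono) auto
  finally have "?n * ?n \<le> 1 * ?n"
    by (simp add: power2_eq_square)
  then show "?n \<le> 1"
    by (cases "?n = 0") (simp, metis mult_right_le_imp_le vec_norm_nonneg less_eq_real_def)
qed

text \<open>The \<open>{} {}\<close> entry is the expectation in the all-zero state. Conjugation by
  \<open>Q\<close> replaces that state by its image under \<open>Q\<close>, which is the column of
  \<open>Q\<close> at \<open>{}\<close>.\<close>

lemma expectation_eq_braket:
  assumes Q: "supp T Q"
  shows "entry (adj Q * lift T M * Q) {} {} =
    braket T (\<lambda>x. entry Q x {}) (op_apply T M (\<lambda>x. entry Q x {}))"
proof -
  have T: "finite T" using Q by (rule supp_finite)
  have MQ: "entry (lift T M * Q) x {} = (\<Sum>y\<in>Pow T. M x y * entry Q y {})" if "x \<subseteq> T" for x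
    unfolding entry_mult_subset[OF supp_lift[OF T] that]
    by (intro sum.cong refl) (use T that in auto)
  have "entry (adj Q * (lift T M * Q)) {} {} = (\<Sum>x\<in>Pow T. cnj (entry Q x {}) * (\<Sum>y\<in>Pow T. M x y * entry Q y {}))"
    unfolding entry_mult_subset[OF supp_adj[OF Q] empty_subsetI]
    by (intro sum.cong refl) (auto simp: entry_adj MQ)
  then show ?thesis by (simp add: mult.assoc braket_def op_apply_def)
qed

lemma isometry_column_norm:
  assumes Q: "supp T Q" "adj Q * Q = 1"
  shows "(\<Sum>x\<in>Pow T. (cmod (entry Q x {}))\<^sup>2) = 1"
proof -
  have "complex_of_real 1 = entry (adj Q * Q) {} {}"
    using Q(2) by (simp add: entry_1 op_one_def)
  also have "\<dots> = (\<Sum>x\<in>Pow T. of_real ((cmod (entry Q x {}))\<^sup>2))"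
    unfolding entry_mult_subset[OF supp_adj[OF Q(1)] empty_subsetI]
    by (intro sum.cong refl) (simp add: entry_adj complex_norm_square mult.commute del: of_real_power)
  also have "\<dots> = of_real (\<Sum>x\<in>Pow T. (cmod (entry Q x {}))\<^sup>2)"
    by simp
  finally show ?thesis by (metis of_real_eq_iff)
qed

text \<open>The bridge from operator norm bounds, such as Lieb-Robinson, to the expectation values
  estimated in the algebra.\<close>

lemma expectation_le_opnorm:
  assumes Q: "supp T Q" "adj Q * Q = 1"
  shows "cmod (entry (adj Q * lift T M * Q) {} {}) \<le> opnorm T M"
proof -
  let ?\<psi> = "\<lambda>x. entry Q x {}"
  have \<psi>: "vec_norm T ?\<psi> = 1"
    using isometry_column_norm[OF Q] by (simp add: vec_norm_def L2_set_def)
  have "cmod (entry (adj Q * lift T M * Q) {} {}) \<le> vec_norm T ?\<psi> * vec_norm T (op_apply T M ?\<psi>)"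
    unfolding expectation_eq_braket[OF Q(1)] by (rule cmod_braket_le)
  also have "\<dots> \<le> opnorm T M"
    using vec_norm_apply_le[OF supp_finite[OF Q(1)], of ?\<psi> M] by (simp add: \<psi>)
  finally show ?thesis .
qed

section \<open>Hamiltonians and evolutions in the algebra\<close>

definition hamop :: "(nat set \<Rightarrow> qop) \<Rightarrow> nat set \<Rightarrow> locop" where
  "hamop h S = (\<Sum>X\<in>Pow S. lift X (h X))"

definition evop :: "(nat set \<Rightarrow> qop) \<Rightarrow> nat set \<Rightarrow> real \<Rightarrow> locop" where
  "evop h S = flow (cscale (- \<i>) (hamop h S))"

lemma lift_ham:
  assumes "finite T" "S \<subseteq> T"
  shows "lift T (ham h S) = hamop h S"
  using assms unfolding ham_def hamop_def
  by (simp add: lift_sum) (intro sum.cong refl lift_tens_id, auto)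

lemma cscale_cscale: "cscale c (cscale d A) = cscale (c * d) A"
  by (rule locop_eqI) (simp add: entry_cscale)

text \<open>The right-hand side does not depend on \<open>T\<close>. Hence the restricted evolution
  in the Lieb-Robinson assumption, taken on the whole chain, and the one in the local cost, taken on
  a region, are the same element.\<close>

lemma lift_evol:
  assumes "finite T" "S \<subseteq> T"
  shows "lift T (evol T (ham h S) s) = evop h S s"
proof -
  have "lift T (\<lambda>x y. - \<i> * of_real s * ham h S x y) = cscale (of_real s) (cscale (- \<i>) (hamop h S))"
    using lift_cscale[OF assms(1), of "- \<i> * of_real s" "ham h S"]
    by (simp add: lift_ham assms cscale_cscale mult.commute)
  then show ?thesis
    unfolding evol_def lift_op_exp[OF assms(1)] evop_def flow_def by simp
qed

lemma supp_hamop: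
  assumes "finite S"
  shows "supp S (hamop h S)"
  unfolding hamop_def
proof (rule supp_sum[OF assms])
  fix X assume "X \<in> Pow S"
  then show "supp S (lift X (h X))"
    using assms by (intro supp_mono[OF supp_lift]) (auto dest: finite_subset)
qed

lemma supp_evop: "finite S \<Longrightarrow> supp S (evop h S s)"
  unfolding evop_def by (intro supp_flow supp_cscale supp_hamop)

lemma adj_hamop:
  assumes "finite S" "\<And>X. X \<subseteq> S \<Longrightarrow> hermitian X (h X)"
  shows "adj (hamop h S) = hamop h S"
  unfolding hamop_def adj_sum
proof (intro sum.cong refl)
  fix X assume X: "X \<in> Pow S"
  then have "finite X" using assms(1) finite_subset by blast
  then have "adj (lift X (h X)) = lift X (op_adj (h X))" by (simp add: lift_op_adj)
  also have "\<dots> = lift X (h X)"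
    using X assms(2) by (intro lift_cong) (auto simp: hermitian_def)
  finally show "adj (lift X (h X)) = lift X (h X)" .
qed

lemma adj_generator:
  assumes "adj H = H"
  shows "adj (cscale (- \<i>) H) = - cscale (- \<i>) H"
  by (rule locop_eqI) (simp add: adj_cscale assms entry_cscale entry_uminus)

lemma adj_evop:
  assumes "finite S" "\<And>X. X \<subseteq> S \<Longrightarrow> hermitian X (h X)"
  shows "adj (evop h S s) = evop h S (- s)"
  unfolding evop_def by (intro adj_flow adj_generator adj_hamop assms)

lemma evop_inverse: "evop h S s * evop h S (- s) = 1" "evop h S (- s) * evop h S s = 1"
  by (simp_all add: evop_def flow_inverse flow_inverse')

text \<open>The Lieb-Robinson bound speaks of operators of norm at most 1; rescaling gives a bound
  proportional to the norm of the Hamiltonian term.\<close>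

lemma cmod_commutator_le:
  assumes T: "finite T" and sub: "S \<subseteq> T" "X \<subseteq> T" "X \<noteq> {}" "B \<subseteq> T" "B \<noteq> {}"
    and LR: "lieb_robinson T (ham h S) \<tau> C v \<xi>" and s: "\<bar>s\<bar> \<le> \<tau>"
    and a: "opnorm T (tens_id B a) \<le> 1"
    and R: "supp T R" "adj R * R = 1"
    and A: "A = evop h S (- s) * lift B a * evop h S s"
  shows "cmod (entry (adj R * (A * lift X b - lift X b * A) * R) {} {}) \<le>
    opnorm T (tens_id X b) * (C * exp (- (setdist (real ` B) (real ` X) - v * \<bar>s\<bar>) / \<xi>))"
    (is "?K \<le> ?o * ?c")
proof -
  \<comment> \<open>Dividing by any \<open>n\<close> above the norm, and not by the norm itself,
    avoids a separate case for norm zero. It also shows that the right-hand side of the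
    Lieb-Robinson bound is nonnegative, with no assumption on the sign of \<open>C\<close>.\<close>
  have scaled: "0 \<le> ?c \<and> ?K \<le> n * ?c" if n: "?o < n" for n
  proof -
    have n0: "0 < n" using opnorm_nonneg[OF T, of "tens_id X b"] n by linarith
    define b' where "b' = (\<lambda>x y. of_real (1 / n) * b x y)"
    let ?A = "op_prod T [evol T (ham h S) (- s), tens_id B a, evol T (ham h S) s]"
    let ?comm = "\<lambda>x y. op_mult T ?A (tens_id X b') x y - op_mult T (tens_id X b') ?A x y"
    have "opnorm T (tens_id X b') \<le> cmod (of_real (1 / n)) * ?o"
      unfolding b'_def tens_id_cscale by (rule opnorm_scale_le[OF T])
    also have "\<dots> \<le> 1" using n n0 by (simp add: norm_divide)
    finally have "opnorm T (tens_id X b') \<le> 1" .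
    then have "opnorm T ?comm \<le> ?c"
      using LR s sub a unfolding lieb_robinson_def Let_def by blast
    moreover have "lift T ?comm = cscale (of_real (1 / n)) (A * lift X b - lift X b * A)"
    proof -
      have X: "finite X" using sub T finite_subset by blast
      have "lift T ?A = A"
        using T sub by (simp add: lift_op_prod lift_evol lift_tens_id A mult.assoc)
      moreover have "lift T (tens_id X b') = cscale (of_real (1 / n)) (lift X b)"
        using T X sub by (simp only: lift_tens_id b'_def lift_cscale)
      ultimately have "lift T ?comm = A * cscale (of_real (1 / n)) (lift X b) - cscale (of_real (1 / n)) (lift X b) * A"
        using T by (simp only: lift_minus lift_op_mult)
      then show ?thesis
        by (intro locop_eqI) (simp add: cscale_mult_left cscale_mult_right entry_minus entry_cscale diff_divide_distrib)
    qed
    then have "cmod (entry (adj R * lift T ?comm * R) {} {}) = ?K / n"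
      using n0 by (simp add: cscale_mult_left cscale_mult_right entry_cscale norm_divide)
    ultimately have "?K / n \<le> ?c"
      using expectation_le_opnorm[OF R, of ?comm] by linarith
    moreover have "0 \<le> ?K / n" using n0 by simp
    ultimately have "0 \<le> ?c" "?K \<le> n * ?c"
      using n0 by (linarith, simp only: pos_divide_le_eq mult.commute)
    then show ?thesis by (rule conjI)
  qed
  then have c0: "0 \<le> ?c" using lt_ex gt_ex by blast
  show ?thesis
  proof (rule field_le_epsilon)
    fix e :: real assume e: "0 < e"
    \<comment> \<open>Letting \<open>n\<close> tend to the norm. The denominator
      \<open>?c + 1\<close> stays positive when \<open>?c\<close> is 0.\<close>
    have "?K \<le> (?o + e / (?c + 1)) * ?c"
      using scaled[of "?o + e / (?c + 1)"] e c0 by (auto simp: divide_pos_pos)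
    also have "\<dots> \<le> ?o * ?c + e"
    proof -
      have "e * ?c \<le> e * (?c + 1)" using e by simp
      then have "e / (?c + 1) * ?c \<le> e" using c0 by (simp add: divide_le_eq)
      then show ?thesis by (simp add: distrib_right)
    qed
    finally show "?K \<le> ?o * ?c + e" .
  qed
qed

text \<open>In Duhamel's formula the operator evolves inside \<open>S\<close> only. Terms disjoint
  from \<open>S\<close> commute with it, and terms straddling the boundary obey the Lieb-Robinson
  bound for \<open>S\<close> alone. Each nonzero straddling term meets \<open>D\<close>, so the
  local strength bounds their total norm by \<open>card D * J\<close>, whatever the size of
  \<open>T\<close>.\<close>

lemma restricted_evolution_error:
  fixes J c \<tau> :: real
  assumes T: "finite T" and sub: "S \<subseteq> T'" "T' \<subseteq> T" "B \<subseteq> S" "B \<noteq> {}" "D \<subseteq> T"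
    and herm: "\<And>X. X \<subseteq> T \<Longrightarrow> hermitian X (h X)"
    and strength: "\<And>i. i \<in> T \<Longrightarrow> (\<Sum>X | X \<subseteq> T \<and> i \<in> X. opnorm T (tens_id X (h X))) \<le> J"
    and LR: "lieb_robinson T (ham h S) \<tau> C v \<xi>" and \<tau>: "0 \<le> \<tau>" and c: "0 \<le> c"
    and boundary: "\<And>X. X \<subseteq> T \<Longrightarrow> X \<inter> S \<noteq> {} \<Longrightarrow> \<not> X \<subseteq> S \<Longrightarrow> tens_id X (h X) \<noteq> (\<lambda>x y. 0) \<Longrightarrow>
      X \<inter> D \<noteq> {} \<and> (\<forall>s. 0 \<le> s \<and> s \<le> \<tau> \<longrightarrow> C * exp (- (setdist (real ` B) (real ` X) - v * \<bar>s\<bar>) / \<xi>) \<le> c)"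
    and a: "opnorm T (tens_id B a) \<le> 1"
    and Q: "supp T Q" "adj Q * Q = 1"
  shows "cmod (entry (adj Q * (evop h T' (- \<tau>) * lift B a * evop h T' \<tau> - evop h S (- \<tau>) * lift B a * evop h S \<tau>) * Q) {} {})
    \<le> card D * J * c * \<tau>"
  unfolding evop_def
proof (rule duhamel_bound[OF \<tau> _ _ _ Q(1) _ Q(2)])
  have fin: "finite T'" "finite S" "finite B" "finite D"
    using sub T finite_subset by (metis subset_trans)+
  let ?G = "\<lambda>S. cscale (- \<i>) (hamop h S)"
  show "supp T (?G T')" "supp T (?G S)"
    using sub fin T by (blast intro: supp_cscale supp_mono[OF supp_hamop])+
  show suppA: "supp T (lift B a)"
    using sub fin T by (blast intro: supp_mono[OF supp_lift])
  show "adj (?G T') = - ?G T'"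
    using sub fin herm by (intro adj_generator adj_hamop) auto
  fix s R A
  assume s: "0 \<le> s" "s \<le> \<tau>" and R: "supp T R" "adj R * R = 1"
    and "A = flow (?G S) (- s) * lift B a * flow (?G S) s"
  then have A: "A = evop h S (- s) * lift B a * evop h S s" by (simp add: evop_def)
  have suppA: "supp S A"
    unfolding A using sub fin by (intro supp_mult supp_evop supp_mono[OF supp_lift])
  define E where "E X = entry (adj R * (A * lift X (h X) - lift X (h X) * A) * R) {} {}" for X
  define F where "F = {X. X \<subseteq> T \<and> X \<inter> D \<noteq> {}}"
  let ?o = "\<lambda>X. opnorm T (tens_id X (h X))"
  have F: "finite F" unfolding F_def using T by (auto intro: finite_subset[of _ "Pow T"])
  \<comment> \<open>A term missing \<open>D\<close> is either disjoint from \<open>S\<close>, hence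
    commutes with \<open>A\<close>, or straddles the boundary and is zero by
    \<open>boundary\<close>.\<close>
  have E_out: "E X = 0" if X: "X \<subseteq> T'" "\<not> X \<subseteq> S" "X \<notin> F" for X
  proof (cases "X \<inter> S = {}")
    case True
    have "A * lift X (h X) = lift X (h X) * A"
      using True X fin by (intro supp_disjoint_commute[OF suppA supp_lift]) (auto dest: finite_subset)
    then show ?thesis by (simp add: E_def entry_0)
  next
    case False
    then have "tens_id X (h X) = (\<lambda>x y. 0)"
      using boundary[of X] X sub unfolding F_def by blast
    then have "lift X (h X) = 0"
      by (simp add: lift_def zero_locop_def)
    then show ?thesis by (simp add: E_def entry_0)
  qed
  have E_in: "cmod (E X) \<le> ?o X * c" if X: "X \<subseteq> T'" "\<not> X \<subseteq> S" "X \<in> F" for X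
  proof (cases "tens_id X (h X) = (\<lambda>x y. 0) \<or> X \<inter> S = {}")
    case True
    have "A * lift X (h X) = lift X (h X) * A"
    proof (cases "X \<inter> S = {}")
      case True
      then show ?thesis
        using X fin by (intro supp_disjoint_commute[OF suppA supp_lift]) (auto dest: finite_subset)
    qed (use True in \<open>simp add: lift_def flip: zero_locop_def\<close>)
    then show ?thesis
      using c opnorm_nonneg[OF T] by (simp add: E_def entry_0)
  next
    case False
    have "X \<subseteq> T" "X \<noteq> {}" "B \<subseteq> T" "S \<subseteq> T" using X sub by blast+
    then have "cmod (E X) \<le> ?o X * (C * exp (- (setdist (real ` B) (real ` X) - v * \<bar>s\<bar>) / \<xi>))"
      unfolding E_def using s sub by (intro cmod_commutator_le[OF T _ _ _ _ _ LR _ a R A]) auto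
    also have "\<dots> \<le> ?o X * c"
      using boundary[of X] X sub s False \<open>X \<subseteq> T\<close> opnorm_nonneg[OF T] by (intro mult_left_mono) auto
    finally show ?thesis .
  qed
  have "hamop h T' - hamop h S = (\<Sum>X\<in>Pow T' - Pow S. lift X (h X))"
    unfolding hamop_def using fin sub by (subst sum_diff) auto
  then have "?G T' - ?G S = cscale (- \<i>) (\<Sum>X\<in>Pow T' - Pow S. lift X (h X))"
    by (intro locop_eqI) (metis entry_cscale entry_minus right_diff_distrib)
  then have "adj R * (A * (?G T' - ?G S) - (?G T' - ?G S) * A) * R =
      cscale (- \<i>) (adj R * (A * (\<Sum>X\<in>Pow T' - Pow S. lift X (h X)) - (\<Sum>X\<in>Pow T' - Pow S. lift X (h X)) * A) * R)"
    by (intro locop_eqI)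
      (simp add: right_diff_distrib left_diff_distrib cscale_mult_left cscale_mult_right entry_minus entry_cscale)
  also have "\<dots> = cscale (- \<i>) (\<Sum>X\<in>Pow T' - Pow S. adj R * (A * lift X (h X) - lift X (h X) * A) * R)"
    by (simp add: sum_distrib_left sum_distrib_right sum_subtractf[symmetric])
  finally have "cmod (entry (adj R * (A * (?G T' - ?G S) - (?G T' - ?G S) * A) * R) {} {}) =
      cmod (\<Sum>X\<in>Pow T' - Pow S. E X)"
    by (simp add: entry_cscale entry_sum norm_mult E_def)
  also have "\<dots> \<le> (\<Sum>X\<in>Pow T' - Pow S. cmod (E X))"
    by (rule norm_sum)
  also have "\<dots> = (\<Sum>X\<in>(Pow T' - Pow S) \<inter> F. cmod (E X))"
    using fin E_out by (intro sum.mono_neutral_right) auto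
  also have "\<dots> \<le> (\<Sum>X\<in>(Pow T' - Pow S) \<inter> F. ?o X * c)"
    using E_in by (intro sum_mono) auto
  also have "\<dots> \<le> (\<Sum>X\<in>F. ?o X * c)"
    using F c opnorm_nonneg[OF T] by (intro sum_mono2) auto
  \<comment> \<open>Every \<open>X\<close> in \<open>F\<close> contains a site of \<open>D\<close>;
    counting it once per such site only enlarges the sum, and exchanging the sums brings in the
    local strength.\<close>
  also have "\<dots> \<le> (\<Sum>X\<in>F. \<Sum>i\<in>D. if i \<in> X then ?o X * c else 0)"
  proof (rule sum_mono)
    fix X assume "X \<in> F"
    then obtain i where i: "i \<in> D" "i \<in> X" by (auto simp: F_def)
    have "?o X * c = (if i \<in> X then ?o X * c else 0)" using i by simp
    also have "\<dots> \<le> (\<Sum>i\<in>D. if i \<in> X then ?o X * c else 0)"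
      using i fin c opnorm_nonneg[OF T] by (intro member_le_sum) auto
    finally show "?o X * c \<le> (\<Sum>i\<in>D. if i \<in> X then ?o X * c else 0)" .
  qed
  also have "\<dots> = (\<Sum>i\<in>D. \<Sum>X\<in>F. if i \<in> X then ?o X * c else 0)"
    by (rule sum.swap)
  also have "\<dots> \<le> (\<Sum>i\<in>D. J * c)"
  proof (rule sum_mono)
    fix i assume i: "i \<in> D"
    have "(\<Sum>X\<in>F. if i \<in> X then ?o X * c else 0) = (\<Sum>X | X \<subseteq> T \<and> i \<in> X. ?o X * c)"
      using F i by (subst sum.inter_filter[symmetric]) (auto simp: F_def intro!: sum.cong)
    also have "\<dots> \<le> J * c"
      unfolding sum_distrib_right[symmetric] using i sub c strength by (intro mult_right_mono) auto
    finally show "(\<Sum>X\<in>F. if i \<in> X then ?o X * c else 0) \<le> J * c" .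
  qed
  also have "\<dots> = card D * J * c" by simp
  finally show "cmod (entry (adj R * (A * (?G T' - ?G S) - (?G T' - ?G S) * A) * R) {} {}) \<le> card D * J * c" .
qed

section \<open>Light cones of brick-wall circuits\<close>

lemma finite_chain [simp]: "finite (chain L)"
  by (simp add: chain_def)

lemma region_subset_chain: "region L l j \<subseteq> chain L"
  by (auto simp: region_def)

lemma finite_region [simp]: "finite (region L l j)"
  by (rule finite_subset[OF region_subset_chain]) simp

lemma region_mono: "l \<le> l' \<Longrightarrow> region L l j \<subseteq> region L l' j"
  by (auto simp: region_def)

lemma region_0: "j \<in> chain L \<Longrightarrow> region L 0 j = {j}"
  by (auto simp: region_def)

section \<open>Unitaries and conjugation by gates\<close>

definition unitop :: "locop \<Rightarrow> bool" where
  "unitop A \<longleftrightarrow> adj A * A = 1 \<and> A * adj A = 1"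

lemma unitopD: "unitop A \<Longrightarrow> adj A * A = 1" "unitop A \<Longrightarrow> A * adj A = 1"
  by (simp_all add: unitop_def)

lemma unitop_adj: "unitop A \<Longrightarrow> unitop (adj A)"
  by (simp add: unitop_def)

lemma unitop_1: "unitop 1"
  by (simp add: unitop_def)

lemma unitop_mult:
  assumes "unitop A" "unitop B"
  shows "unitop (A * B)"
proof -
  have "adj (A * B) * (A * B) = adj B * (adj A * A) * B" "A * B * adj (A * B) = A * (B * adj B) * adj A"
    by (simp_all add: adj_mult mult.assoc)
  then show ?thesis using assms by (simp add: unitop_def)
qed

lemma unitop_prod_list: "(\<And>A. A \<in> set As \<Longrightarrow> unitop A) \<Longrightarrow> unitop (prod_list As)"
  by (induction As) (auto intro: unitop_1 unitop_mult)

lemma unitop_lift: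
  assumes "finite S" "unitary S u"
  shows "unitop (lift S u)"
proof -
  have "lift S (op_mult S (op_adj u) u) = lift S op_one" "lift S (op_mult S u (op_adj u)) = lift S op_one"
    using assms(2) by (auto simp: unitary_def intro!: lift_cong)
  then show ?thesis
    using assms(1) by (simp add: unitop_def lift_op_mult lift_op_adj lift_op_one)
qed

lemma conj_disjoint:
  assumes "unitop u" "supp X u" "supp E M" "X \<inter> E = {}"
  shows "u * M * adj u = M" "adj u * M * u = M"
proof -
  have "u * M = M * u" "adj u * M = M * adj u"
    using assms supp_disjoint_commute supp_adj by blast+
  then show "u * M * adj u = M" "adj u * M * u = M"
    using unitopD[OF assms(1)] by (simp_all add: mult.assoc)
qed

text \<open>No gate straddles the boundary of \<open>E\<close>, so conjugation never leaves
  \<open>E\<close>, and gates outside \<open>E\<close> cancel against their adjoints. Comparing two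
  circuits through the gates inside \<open>E\<close> makes the choice of \<open>S\<close>
  immaterial.\<close>

lemma conj_closed:
  assumes u: "\<And>i. i \<in> set xs \<Longrightarrow> unitop (u i)" "\<And>i. i \<in> set xs \<Longrightarrow> supp (X i) (u i)"
    and E: "finite E" "\<And>i. i \<in> set xs \<Longrightarrow> X i \<subseteq> E \<or> X i \<inter> E = {}" "E \<subseteq> S"
    and M: "supp E M"
  defines "P \<equiv> \<lambda>S. prod_list (map u (filter (\<lambda>i. X i \<subseteq> S) xs))"
  shows "P S * M * adj (P S) = P E * M * adj (P E) \<and> supp E (P S * M * adj (P S))"
    and "adj (P S) * M * P S = adj (P E) * M * P E \<and> supp E (adj (P S) * M * P S)"
proof -
  have "P S * M * adj (P S) = P E * M * adj (P E) \<and> supp E (P S * M * adj (P S))"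
    using u E(2) unfolding P_def
  proof (induction xs)
    case Nil
    then show ?case using M by simp
  next
    case (Cons i xs)
    let ?P = "\<lambda>S. prod_list (map u (filter (\<lambda>i. X i \<subseteq> S) xs))"
    let ?N = "?P S * M * adj (?P S)"
    have IH: "?N = ?P E * M * adj (?P E)" "supp E ?N"
      using Cons by auto
    have step: "u i * ?P S' * M * adj (u i * ?P S') = u i * (?P S' * M * adj (?P S')) * adj (u i)" for S'
      by (simp add: adj_mult mult.assoc)
    have i: "unitop (u i)" "supp (X i) (u i)" using Cons.prems by simp_all
    show ?case
    proof (cases "X i \<subseteq> E")
      case True
      then have "supp E (u i)" using i E by (blast intro: supp_mono)
      then have "supp E (u i * ?N * adj (u i))"
        using IH(2) by (blast intro: supp_mult supp_adj)
      moreover have "X i \<subseteq> S" using True E(3) by blast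
      ultimately show ?thesis using True IH(1) by (simp add: step)
    next
      case False
      then have "X i \<inter> E = {}" using Cons.prems by auto
      then have "u i * ?N * adj (u i) = ?N" using i IH(2) conj_disjoint(1) by blast
      then show ?thesis using False IH by (simp add: step)
    qed
  qed
  then show "P S * M * adj (P S) = P E * M * adj (P E) \<and> supp E (P S * M * adj (P S))" .
  \<comment> \<open>Here the first gate of the list is innermost and is absorbed into
    \<open>M\<close>, so the induction needs \<open>M\<close> arbitrary; in the other order it is
    outermost.\<close>
  have "adj (P S) * M * P S = adj (P E) * M * P E \<and> supp E (adj (P S) * M * P S)"
    using u E(2) M unfolding P_def
  proof (induction xs arbitrary: M)
    case Nil
    then show ?case by simp
  next
    case (Cons i xs)
    let ?P = "\<lambda>S. prod_list (map u (filter (\<lambda>i. X i \<subseteq> S) xs))"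
    let ?N = "adj (u i) * M * u i"
    have step: "adj (u i * ?P S') * M * (u i * ?P S') = adj (?P S') * ?N * ?P S'" for S'
      by (simp add: adj_mult mult.assoc)
    have i: "unitop (u i)" "supp (X i) (u i)" using Cons.prems by simp_all
    show ?case
    proof (cases "X i \<subseteq> E")
      case True
      then have "supp E (u i)" using i E by (blast intro: supp_mono)
      then have "supp E ?N" using Cons.prems by (intro supp_mult supp_adj)
      then show ?thesis using True E(3) Cons.prems Cons.IH[of ?N] by (auto simp: step)
    next
      case False
      then have "X i \<inter> E = {}" using Cons.prems by auto
      then have "?N = M" using i Cons.prems conj_disjoint(2) by blast
      then show ?thesis using False Cons.prems Cons.IH[of M] by (auto simp: step)
    qed
  qed
  then show "adj (P S) * M * P S = adj (P E) * M * P E \<and> supp E (adj (P S) * M * P S)" .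
qed

text \<open>Regions are indexed by their diameter, so \<open>l + 2 * n\<close> means \<open>n\<close> more sites on each side.\<close>

definition lightcone :: "nat \<Rightarrow> nat \<Rightarrow> nat set \<Rightarrow> nat \<Rightarrow> locop \<Rightarrow> locop \<Rightarrow> bool" where
  "lightcone L j S n P P' \<longleftrightarrow> (\<forall>l M. supp (region L l j) M \<and> region L (l + 2 * real n) j \<subseteq> S \<longrightarrow>
     P * M * adj P = P' * M * adj P' \<and> supp (region L (l + 2 * real n) j) (P * M * adj P))"

lemma lightconeD:
  assumes "lightcone L j S n P P'" "supp (region L l j) M" "region L (l + 2 * real n) j \<subseteq> S"
  shows "P * M * adj P = P' * M * adj P'" "supp (region L (l + 2 * real n) j) (P * M * adj P)"
  using assms unfolding lightcone_def by blast+

lemma lightcone_1: "lightcone L j S 0 1 1"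
  by (simp add: lightcone_def)

text \<open>In the conjugation by \<open>P * Q\<close> the factor \<open>Q\<close> acts first, so
  the radii add. The intermediate region lies in the final one and so in \<open>S\<close>.\<close>

lemma lightcone_mult:
  assumes Q: "lightcone L j S m Q Q'" and P: "lightcone L j S n P P'"
  shows "lightcone L j S (m + n) (P * Q) (P' * Q')"
  unfolding lightcone_def
proof (intro allI impI)
  fix l M
  assume "supp (region L l j) M \<and> region L (l + 2 * real (m + n)) j \<subseteq> S"
  then have M: "supp (region L l j) M" and S: "region L (l + 2 * real m + 2 * real n) j \<subseteq> S"
    by (simp_all add: algebra_simps)
  have "region L (l + 2 * real m) j \<subseteq> S"
    using S region_mono[of "l + 2 * real m" "l + 2 * real m + 2 * real n" L j] by simp
  note 1 = lightconeD[OF Q M this]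
  note 2 = lightconeD[OF P 1(2) S]
  have eq: "P * Q * M * adj (P * Q) = P * (Q * M * adj Q) * adj P" for P Q
    by (simp add: adj_mult mult.assoc)
  have len: "l + 2 * real (m + n) = l + 2 * real m + 2 * real n"
    by simp
  show "P * Q * M * adj (P * Q) = P' * Q' * M * adj (P' * Q') \<and>
      supp (region L (l + 2 * real (m + n)) j) (P * Q * M * adj (P * Q))"
    unfolding eq len 1(1)[symmetric] using 2 by blast
qed

text \<open>The gates of a half layer are disjoint, so adding to the region all gates that touch it
  yields a set that no gate straddles. This enlarges the region by at most one site on each
  side.\<close>

lemma half_layer_lightcone:
  assumes u: "\<And>i. i \<in> set xs \<Longrightarrow> unitop (u i)" "\<And>i. i \<in> set xs \<Longrightarrow> supp {i, Suc i} (u i)"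
    and sites: "\<And>i. i \<in> set xs \<Longrightarrow> {i, Suc i} \<subseteq> chain L"
    and disj: "\<And>i i'. i \<in> set xs \<Longrightarrow> i' \<in> set xs \<Longrightarrow> i \<noteq> i' \<Longrightarrow> {i, Suc i} \<inter> {i', Suc i'} = {}"
  defines "P \<equiv> \<lambda>S. prod_list (map u (filter (\<lambda>i. {i, Suc i} \<subseteq> S) xs))"
  shows "lightcone L j S 1 (P S) (P (chain L)) \<and> lightcone L j S 1 (adj (P S)) (adj (P (chain L)))"
  unfolding lightcone_def
proof (intro conjI allI impI; elim conjE)
  fix l M
  assume M: "supp (region L l j) M" and S: "region L (l + 2 * real 1) j \<subseteq> S"
  define E where "E = region L l j \<union> (\<Union>i\<in>{i \<in> set xs. {i, Suc i} \<inter> region L l j \<noteq> {}}. {i, Suc i})"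
  have sub: "E \<subseteq> region L (l + 2 * real 1) j"
  proof
    fix x assume "x \<in> E"
    then consider "x \<in> region L l j"
      | i y where "i \<in> set xs" "x \<in> {i, Suc i}" "y \<in> {i, Suc i}" "y \<in> region L l j"
      unfolding E_def by blast
    then show "x \<in> region L (l + 2 * real 1) j"
    proof cases
      case 1
      then show ?thesis using region_mono[of l "l + 2 * real 1"] by auto
    next
      case 2
      then have "x \<in> chain L" "\<bar>real y - real x\<bar> \<le> 1" using sites[of i] by auto
      moreover have "\<bar>real j - real y\<bar> \<le> l / 2" using 2 by (simp add: region_def dist_real_def)
      moreover have "\<bar>real j - real x\<bar> \<le> \<bar>real j - real y\<bar> + \<bar>real y - real x\<bar>"
        by (rule order_trans[OF _ abs_triangle_ineq]) simp
      ultimately show ?thesis by (simp add: region_def dist_real_def)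
    qed
  qed
  then have E: "finite E" by (rule finite_subset) simp
  have closed: "{i, Suc i} \<subseteq> E \<or> {i, Suc i} \<inter> E = {}" if i: "i \<in> set xs" for i
  proof (rule disjCI)
    assume "{i, Suc i} \<inter> E \<noteq> {}"
    then consider "{i, Suc i} \<inter> region L l j \<noteq> {}"
      | i' where "i' \<in> set xs" "{i', Suc i'} \<inter> region L l j \<noteq> {}" "{i, Suc i} \<inter> {i', Suc i'} \<noteq> {}"
      unfolding E_def by blast
    then have "{i, Suc i} \<inter> region L l j \<noteq> {}"
    proof cases
      case 2
      then have "i = i'" using disj[OF i, of i'] by blast
      then show ?thesis using 2 by simp
    qed
    then show "{i, Suc i} \<subseteq> E" unfolding E_def using i by blast
  qed
  have ME: "supp E M" using M by (rule supp_mono[OF _ _ E]) (auto simp: E_def)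
  have ES: "E \<subseteq> S" "E \<subseteq> chain L" using sub S region_subset_chain by blast+
  have conj: "P S' * M * adj (P S') = P E * M * adj (P E) \<and> supp E (P S' * M * adj (P S'))"
    "adj (P S') * M * P S' = adj (P E) * M * P E \<and> supp E (adj (P S') * M * P S')" if "E \<subseteq> S'" for S'
    unfolding P_def
    by (rule conj_closed[where X = "\<lambda>i. {i, Suc i}" and xs = xs, OF u E closed that ME];
      assumption)+
  show "P S * M * adj (P S) = P (chain L) * M * adj (P (chain L))"
    "adj (P S) * M * adj (adj (P S)) = adj (P (chain L)) * M * adj (adj (P (chain L)))"
    using conj[OF ES(1)] conj[OF ES(2)] by simp_all
  show "supp (region L (l + 2 * real 1) j) (P S * M * adj (P S))"
    "supp (region L (l + 2 * real 1) j) (adj (P S) * M * adj (adj (P S)))"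
    unfolding adj_adj using conj[OF ES(1)] supp_mono[OF _ sub finite_region] by blast+
qed

section \<open>Brick-wall circuits in the algebra\<close>

definition layer :: "nat \<Rightarrow> (nat \<Rightarrow> nat \<Rightarrow> qop) \<Rightarrow> nat \<Rightarrow> nat set \<Rightarrow> locop" where
  "layer L g l S = prod_list (map (\<lambda>i. lift {i, Suc i} (g l i)) (filter (\<lambda>i. {i, Suc i} \<subseteq> S) (brick_sites L)))"

definition circuit :: "nat \<Rightarrow> nat \<Rightarrow> (nat \<Rightarrow> nat \<Rightarrow> qop) \<Rightarrow> nat set \<Rightarrow> locop" where
  "circuit L d g S = prod_list (map (\<lambda>l. layer L g l S) [1..<d + 1])"

lemma concat_map_if: "concat (map (\<lambda>i. if P i then [f i] else []) xs) = map f (filter P xs)"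
  by (induction xs) auto

lemma prod_list_concat: "prod_list (concat xss) = prod_list (map prod_list xss)"
  for xss :: "locop list list"
  by (induction xss) auto

lemma lift_brickwall:
  assumes "finite S"
  shows "lift S (brickwall L d g S) = circuit L d g S"
proof -
  have "map (lift S \<circ> (\<lambda>i. tens_id {i, Suc i} (g l i))) (filter (\<lambda>i. {i, Suc i} \<subseteq> S) xs) =
      map (\<lambda>i. lift {i, Suc i} (g l i)) (filter (\<lambda>i. {i, Suc i} \<subseteq> S) xs)" for l xs
    using assms by (auto intro!: lift_tens_id)
  then show ?thesis
    unfolding brickwall_def circuit_def layer_def
    by (simp only: lift_op_prod[OF assms] concat_map_if map_concat prod_list_concat map_map o_def)
qed

lemma supp_circuit:
  assumes "finite S"
  shows "supp S (circuit L d g S)"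
  unfolding circuit_def layer_def using assms
  by (auto simp del: upt_Suc intro!: supp_prod_list supp_mono[OF supp_lift])

lemma brick_sites_bounds: "i \<in> set (brick_sites L) \<Longrightarrow> 1 \<le> i \<and> i < L"
  by (auto simp: brick_sites_def)

lemma unitop_layer:
  assumes "gates L d g" "l \<in> {1..d}"
  shows "unitop (layer L g l S)"
  unfolding layer_def
proof (rule unitop_prod_list)
  fix A assume "A \<in> set (map (\<lambda>i. lift {i, Suc i} (g l i)) (filter (\<lambda>i. {i, Suc i} \<subseteq> S) (brick_sites L)))"
  then obtain i where "i \<in> set (brick_sites L)" "A = lift {i, Suc i} (g l i)" by auto
  then show "unitop A"
    using assms brick_sites_bounds[of i L] by (auto simp: gates_def intro!: unitop_lift)
qed

lemma unitop_circuit: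
  assumes "gates L d g"
  shows "unitop (circuit L d g S)"
  unfolding circuit_def by (rule unitop_prod_list) (auto intro!: unitop_layer[OF assms])

lemma layer_lightcone:
  assumes g: "gates L d g" and l: "l \<in> {1..d}"
  shows "lightcone L j S 2 (layer L g l S) (layer L g l (chain L)) \<and>
    lightcone L j S 2 (adj (layer L g l S)) (adj (layer L g l (chain L)))"
proof -
  define odds where "odds = map (\<lambda>i. 2 * i - 1) [1..<L div 2 + 1]"
  define evens where "evens = map (\<lambda>i. 2 * i) [1..<L div 2]"
  have sites: "brick_sites L = odds @ evens"
    by (simp add: brick_sites_def odds_def evens_def)
  define P where "P xs S = prod_list (map (\<lambda>i. lift {i, Suc i} (g l i)) (filter (\<lambda>i. {i, Suc i} \<subseteq> S) xs))"
    for xs S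
  have half: "lightcone L j S 1 (P xs S) (P xs (chain L)) \<and> lightcone L j S 1 (adj (P xs S)) (adj (P xs (chain L)))"
    if xs: "set xs \<subseteq> set (brick_sites L)" "\<And>i i'. i \<in> set xs \<Longrightarrow> i' \<in> set xs \<Longrightarrow> even i = even i'" for xs
    unfolding P_def
  proof (rule half_layer_lightcone)
    fix i assume i: "i \<in> set xs"
    then have b: "1 \<le> i" "i < L" using xs(1) brick_sites_bounds by auto
    then show "unitop (lift {i, Suc i} (g l i))"
      using g l by (auto simp: gates_def intro!: unitop_lift)
    show "supp {i, Suc i} (lift {i, Suc i} (g l i))" by (simp add: supp_lift)
    show "{i, Suc i} \<subseteq> chain L" using b by (auto simp: chain_def)
    \<comment> \<open>Distinct first sites of equal parity differ by at least 2, so their gates do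
      not overlap.\<close>
    fix i' assume i': "i' \<in> set xs" "i \<noteq> i'"
    have "even i = even i'" using xs(2) i i' by blast
    then show "{i, Suc i} \<inter> {i', Suc i'} = {}" using i' by auto
  qed
  have "odd i" if "i \<in> set odds" for i using that by (auto simp: odds_def)
  moreover have "even i" if "i \<in> set evens" for i using that by (auto simp: evens_def)
  ultimately have halves: "lightcone L j S 1 (P odds S) (P odds (chain L))"
      "lightcone L j S 1 (adj (P odds S)) (adj (P odds (chain L)))"
      "lightcone L j S 1 (P evens S) (P evens (chain L))"
      "lightcone L j S 1 (adj (P evens S)) (adj (P evens (chain L)))"
    using half[of odds] half[of evens] by (auto simp: sites)
  have "layer L g l S = P odds S * P evens S" for S
    by (simp add: layer_def sites P_def)
  \<comment> \<open>Taking adjoints reverses the order of the two halves, hence the different order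
    of the facts.\<close>
  then show ?thesis
    using lightcone_mult[OF halves(3,1)] lightcone_mult[OF halves(2,4)]
    by (simp add: adj_mult numeral_2_eq_2)
qed

lemma circuit_lightcone:
  assumes g: "gates L d g"
  shows "lightcone L j S (2 * d) (circuit L d g S) (circuit L d g (chain L)) \<and>
    lightcone L j S (2 * d) (adj (circuit L d g S)) (adj (circuit L d g (chain L)))"
  using g
proof (induction d)
  case 0
  then show ?case by (simp add: circuit_def lightcone_1)
next
  case (Suc d)
  have "gates L d g" using Suc.prems by (auto simp: gates_def)
  note IH = Suc.IH[OF this]
  note new = layer_lightcone[OF Suc.prems, of "Suc d" j S, simplified]
  have Suc_d: "circuit L (Suc d) g S = circuit L d g S * layer L g (Suc d) S" for S
    by (simp add: circuit_def)
  \<comment> \<open>The new layer is the rightmost factor: innermost when conjugating with the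
    circuit, outermost when conjugating with its adjoint. The order of the radii follows.\<close>
  have "lightcone L j S (2 + 2 * d) (circuit L (Suc d) g S) (circuit L (Suc d) g (chain L))"
    unfolding Suc_d using IH new by (intro lightcone_mult) blast+
  moreover have "lightcone L j S (2 * d + 2) (adj (circuit L (Suc d) g S)) (adj (circuit L (Suc d) g (chain L)))"
    unfolding Suc_d adj_mult using IH new by (intro lightcone_mult) blast+
  ultimately show ?case by simp
qed

section \<open>Comparison of the costs\<close>

lemma op_apply_ket0:
  assumes "finite S"
  shows "op_apply S X ket0 = (\<lambda>x. X x {})"
proof
  fix x
  have "op_apply S X ket0 x = (\<Sum>y\<in>Pow S. if y = {} then X x y else 0)"
    unfolding op_apply_def by (rule sum.cong) (auto simp: ket0_def)
  then show "op_apply S X ket0 x = X x {}" using assms by simp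
qed

lemma braket_ket0:
  assumes "finite S"
  shows "braket S ket0 (op_apply S X ket0) = X {} {}"
proof -
  have "braket S ket0 (op_apply S X ket0) = (\<Sum>x\<in>Pow S. if x = {} then X x {} else 0)"
    unfolding braket_def op_apply_ket0[OF assms] by (rule sum.cong) (auto simp: ket0_def)
  then show ?thesis using assms by simp
qed

definition Pi0 :: "nat \<Rightarrow> locop" where
  "Pi0 j = lift {j} (proj0 j)"

lemma lift_proj0: "finite S \<Longrightarrow> j \<in> S \<Longrightarrow> lift S (proj0 j) = Pi0 j"
  unfolding Pi0_def proj0_def by (simp add: lift_tens_id)

lemma entry_Pi0: "entry (Pi0 j) x y = (if x = y \<and> j \<notin> x then 1 else 0)"
  unfolding Pi0_def by (auto simp: entry_lift proj0_def tens_id_def)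

lemma supp_Pi0: "supp {j} (Pi0 j)"
  by (simp add: Pi0_def supp_lift)

lemma adj_Pi0: "adj (Pi0 j) = Pi0 j"
  by (rule locop_eqI) (auto simp: entry_adj entry_Pi0)

lemma Pi0_idem: "Pi0 j * Pi0 j = Pi0 j"
proof (rule locop_eqI_supp[of "{j}"])
  fix x y assume "x \<subseteq> {j}"
  then have "entry (Pi0 j * Pi0 j) x y = (\<Sum>z\<in>Pow {j}. if z = x then entry (Pi0 j) x y else 0)"
    unfolding entry_mult_subset[OF supp_Pi0 \<open>x \<subseteq> {j}\<close>] by (intro sum.cong) (auto simp: entry_Pi0)
  then show "entry (Pi0 j * Pi0 j) x y = entry (Pi0 j) x y"
    using \<open>x \<subseteq> {j}\<close> by simp
qed (intro supp_mult supp_Pi0)+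

text \<open>The bracketing follows the order of the argument: the measured projector is spread by
  \<open>W\<close>, then by \<open>V\<close>, then by the time evolution, and finally by the adjoint
  of \<open>W\<close>.\<close>

definition heis :: "locop \<Rightarrow> locop \<Rightarrow> locop \<Rightarrow> nat \<Rightarrow> locop" where
  "heis W U V j = adj W * (adj U * (V * (W * Pi0 j * adj W) * adj V) * U) * W"

lemma cost_LLET_heis:
  assumes "finite S" "j \<in> S"
  shows "cost_LLET S N W j U V =
    1 - (\<Sum>k<N. Re (entry (heis (lift S (W k)) (lift S U) (lift S V) j) {} {})) / N"
proof -
  have "braket S ket0 (op_apply S (op_prod S [op_adj (W k), op_adj U, V, W k, proj0 j, op_adj (W k), op_adj V, U, W k]) ket0)
      = entry (heis (lift S (W k)) (lift S U) (lift S V) j) {} {}" for k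
  proof -
    let ?X = "op_prod S [op_adj (W k), op_adj U, V, W k, proj0 j, op_adj (W k), op_adj V, U, W k]"
    have "lift S ?X = heis (lift S (W k)) (lift S U) (lift S V) j"
      using assms by (simp add: lift_op_prod lift_op_adj lift_proj0 heis_def mult.assoc)
    then show ?thesis
      using entry_lift_subset[OF assms(1), of "{}" "{}" ?X] by (simp add: braket_ket0[OF assms(1)])
  qed
  then show ?thesis by (simp add: cost_LLET_def)
qed

text \<open>\<open>p k x\<close> is the probability of outcome \<open>x\<close> when the state
  \<open>F k\<close> applied to all zeros is measured. The LET term is the probability of the empty
  outcome, the LLET term at \<open>j\<close> that of outcomes avoiding \<open>j\<close>.\<close>

lemma cost_LET_le:
  assumes N: "1 \<le> N" and L: "1 \<le> L"
    and U: "unitop (lift (chain L) U)" and V: "unitop (lift (chain L) V)"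
    and W: "\<And>k. k < N \<Longrightarrow> unitop (lift (chain L) (W k))"
  shows "cost_LET L N (\<lambda>k. op_apply (chain L) (W k) ket0) U V \<le> L * cost_LLET_full L N W U V"
proof -
  let ?T = "chain L"
  define F where "F k = adj (lift ?T (W k)) * adj (lift ?T V) * lift ?T U * lift ?T (W k)" for k
  define p where "p k x = (cmod (entry (F k) x {}))\<^sup>2" for k x
  have suppF: "supp ?T (F k)" for k
    unfolding F_def by (intro supp_mult supp_adj supp_lift) simp_all
  have p1: "(\<Sum>x\<in>Pow ?T. p k x) = 1" if "k < N" for k
    unfolding p_def
    by (intro isometry_column_norm suppF unitopD(1))
      (auto simp: F_def intro!: unitop_mult unitop_adj U V W that)
  have LET: "(cmod (braket ?T (op_apply ?T (W k) ket0)
      (op_apply ?T (op_prod ?T [op_adj V, U]) (op_apply ?T (W k) ket0))))\<^sup>2 = p k {}" for k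
  proof -
    \<comment> \<open>\<open>W k\<close> and its lift need agree only on subsets of the chain, the
      only indices that enter here.\<close>
    have col: "braket ?T (op_apply ?T (W k) ket0) (op_apply ?T M (op_apply ?T (W k) ket0)) =
        braket ?T (\<lambda>x. entry (lift ?T (W k)) x {}) (op_apply ?T M (\<lambda>x. entry (lift ?T (W k)) x {}))" for M
      unfolding op_apply_ket0[OF finite_chain]
      unfolding braket_def op_apply_def
      by (intro sum.cong refl arg_cong2[of _ _ _ _ "(*)"]) auto
    show ?thesis
      unfolding col expectation_eq_braket[OF supp_lift[OF finite_chain], symmetric] p_def F_def
      by (simp add: lift_op_prod lift_op_adj mult.assoc)
  qed
  have LLET: "Re (entry (heis (lift ?T (W k)) (lift ?T U) (lift ?T V) j) {} {}) =
      (\<Sum>x\<in>Pow ?T. if j \<in> x then 0 else p k x)" if j: "j \<in> ?T" for j k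
  proof -
    have "heis (lift ?T (W k)) (lift ?T U) (lift ?T V) j = adj (F k) * Pi0 j * F k"
      by (simp add: heis_def F_def adj_mult mult.assoc)
    also have "entry \<dots> {} {} = entry (adj (F k) * (Pi0 j * F k)) {} {}"
      by (simp add: mult.assoc)
    also have "\<dots> = (\<Sum>x\<in>Pow ?T. cnj (entry (F k) x {}) * (if j \<in> x then 0 else entry (F k) x {}))"
      unfolding entry_mult_subset[OF supp_adj[OF suppF] empty_subsetI]
    proof (intro sum.cong refl)
      fix x assume x: "x \<in> Pow ?T"
      have Pi: "supp ?T (Pi0 j)" using j by (intro supp_mono[OF supp_Pi0]) auto
      have "entry (Pi0 j * F k) x {} = (\<Sum>z\<in>Pow ?T. if z = x then (if j \<in> x then 0 else entry (F k) x {}) else 0)"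
        unfolding entry_mult_subset[OF Pi PowD[OF x]] by (intro sum.cong) (auto simp: entry_Pi0)
      then show "entry (adj (F k)) {} x * entry (Pi0 j * F k) x {} =
          cnj (entry (F k) x {}) * (if j \<in> x then 0 else entry (F k) x {})"
        using x by (simp add: entry_adj)
    qed
    also have "Re \<dots> = (\<Sum>x\<in>Pow ?T. if j \<in> x then 0 else p k x)"
      unfolding Re_sum
    proof (intro sum.cong refl)
      show "Re (cnj (entry (F k) x {}) * (if j \<in> x then 0 else entry (F k) x {})) =
          (if j \<in> x then 0 else p k x)" for x
        using cmod_power2[of "entry (F k) x {}"] by (simp add: p_def power2_eq_square)
    qed
    finally show ?thesis .
  qed
  have union_bound: "1 - p k {} \<le> (\<Sum>j\<in>?T. 1 - (\<Sum>x\<in>Pow ?T. if j \<in> x then 0 else p k x))" if k: "k < N" for k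
  proof -
    have "1 - p k {} = (\<Sum>x\<in>Pow ?T. p k x - (if x = {} then p k x else 0))"
      by (simp add: sum_subtractf p1[OF k])
    \<comment> \<open>A nonempty outcome contains at least one site, so its probability is counted
      at least once.\<close>
    also have "\<dots> \<le> (\<Sum>x\<in>Pow ?T. \<Sum>j\<in>?T. if j \<in> x then p k x else 0)"
    proof (intro sum_mono)
      fix x assume x: "x \<in> Pow ?T"
      show "p k x - (if x = {} then p k x else 0) \<le> (\<Sum>j\<in>?T. if j \<in> x then p k x else 0)"
      proof (cases "x = {}")
        case False
        then obtain i where i: "i \<in> x" "i \<in> ?T" using x by auto
        have "(if i \<in> x then p k x else 0) \<le> (\<Sum>j\<in>?T. if j \<in> x then p k x else 0)"
          using i by (intro member_le_sum) (auto simp: p_def)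
        then show ?thesis using False i by simp
      qed simp
    qed
    also have "\<dots> = (\<Sum>j\<in>?T. \<Sum>x\<in>Pow ?T. p k x - (if j \<in> x then 0 else p k x))"
      by (subst sum.swap) (intro sum.cong refl, auto)
    also have "\<dots> = (\<Sum>j\<in>?T. 1 - (\<Sum>x\<in>Pow ?T. if j \<in> x then 0 else p k x))"
      by (simp add: sum_subtractf p1[OF k])
    finally show ?thesis .
  qed
  have avg: "1 - (\<Sum>k<N. f k) / real N = (\<Sum>k<N. 1 - f k) / real N" for f :: "nat \<Rightarrow> real"
    using N by (simp add: sum_subtractf diff_divide_distrib)
  have "cost_LET L N (\<lambda>k. op_apply ?T (W k) ket0) U V = (\<Sum>k<N. 1 - p k {}) / N"
    by (simp add: cost_LET_def LET avg)
  also have "\<dots> \<le> (\<Sum>k<N. \<Sum>j\<in>?T. 1 - (\<Sum>x\<in>Pow ?T. if j \<in> x then 0 else p k x)) / N"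
    using union_bound by (intro divide_right_mono sum_mono) auto
  also have "\<dots> = (\<Sum>j\<in>?T. (\<Sum>k<N. 1 - (\<Sum>x\<in>Pow ?T. if j \<in> x then 0 else p k x)) / N)"
    by (simp add: sum.swap[of _ ?T] sum_divide_distrib)
  also have "\<dots> = (\<Sum>j\<in>?T. cost_LLET ?T N W j U V)"
    by (intro sum.cong refl) (simp only: cost_LLET_heis[OF finite_chain] LLET avg)
  also have "\<dots> = L * cost_LLET_full L N W U V"
    using L by (simp add: cost_LLET_full_def chain_def)
  finally show ?thesis .
qed

text \<open>The integer distances allowed lie among \<open>\<lceil>r\<rceil> + 1\<close> consecutive
  values, each attained by at most one site on either side of \<open>j\<close>. The bound is free of
  \<open>L\<close>, \<open>a\<close> and \<open>j\<close>, which makes the error constant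
  uniform.\<close>

lemma card_annulus_le:
  assumes "0 \<le> r"
  shows "card {i \<in> chain L. a < \<bar>real i - real j\<bar> \<and> \<bar>real i - real j\<bar> \<le> a + r} \<le> 2 * (nat \<lceil>r\<rceil> + 1)"
    (is "card ?D \<le> _")
proof -
  let ?I = "{\<lfloor>a\<rfloor> + 1..\<lfloor>a\<rfloor> + \<lceil>r\<rceil> + 1}"
  have "?D \<subseteq> (\<lambda>m. nat (int j + m)) ` ?I \<union> (\<lambda>m. nat (int j - m)) ` ?I"
  proof
    fix i assume i: "i \<in> ?D"
    define m where "m = \<bar>int i - int j\<bar>"
    have m: "a < real_of_int m" "real_of_int m \<le> a + r"
      using i by (simp_all add: m_def)
    have "\<lfloor>a\<rfloor> < m" using m(1) by linarith
    moreover have "real_of_int m < real_of_int (\<lfloor>a\<rfloor> + 1 + \<lceil>r\<rceil> + 1)" using m(2) by linarith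
    then have "m < \<lfloor>a\<rfloor> + 1 + \<lceil>r\<rceil> + 1" by (simp only: of_int_less_iff)
    ultimately have "m \<in> ?I" by simp
    moreover have "i = nat (int j + m) \<or> i = nat (int j - m)"
      unfolding m_def by (auto simp: abs_if)
    ultimately show "i \<in> (\<lambda>m. nat (int j + m)) ` ?I \<union> (\<lambda>m. nat (int j - m)) ` ?I"
      by blast
  qed
  then have "card ?D \<le> card ((\<lambda>m. nat (int j + m)) ` ?I \<union> (\<lambda>m. nat (int j - m)) ` ?I)"
    by (intro card_mono) auto
  also have "\<dots> \<le> card ((\<lambda>m. nat (int j + m)) ` ?I) + card ((\<lambda>m. nat (int j - m)) ` ?I)"
    by (rule card_Un_le)
  also have "\<dots> \<le> card ?I + card ?I"
    by (intro add_mono card_image_le) auto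
  also have "\<dots> = 2 * (nat \<lceil>r\<rceil> + 1)"
    using assms by (simp add: nat_add_distrib)
  finally show ?thesis .
qed

text \<open>Three nested diameters: \<open>b\<close> for the spread projector, \<open>l'\<close> for
  the common restricted evolution, \<open>l\<close> for the local subsystem. The outer factor 2
  comes from comparing both the full and the local evolution with the restricted one.\<close>

lemma local_heis_error:
  fixes J v \<xi> C \<tau> l\<^sub>0 l l' r b :: real
  assumes r: "0 \<le> r" and v: "0 \<le> v" and \<xi>: "0 < \<xi>" and \<tau>: "0 \<le> \<tau>"
    and j: "j \<in> chain L"
    and ham: "local_hamiltonian L r J h"
    and LR: "lieb_robinson (chain L) (ham h (region L l' j)) \<tau> C v \<xi>"
    and V: "gates L dV gV" and W: "gates L dW gW"
    and b: "4 * (real dV + real dW) \<le> b"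
    and l': "2 * (l\<^sub>0 + r + v * \<tau>) + b \<le> l'" "b \<le> l'" and l: "l' + 4 * real dW \<le> l"
  defines "S \<equiv> region L l j" and "T \<equiv> chain L"
  shows "cmod (entry (heis (circuit L dW gW T) (evop h T \<tau>) (circuit L dV gV T) j) {} {} -
      entry (heis (circuit L dW gW S) (evop h S \<tau>) (circuit L dV gV S) j) {} {})
    \<le> 2 * (2 * (nat \<lceil>r\<rceil> + 1) * \<bar>J\<bar> * (\<bar>C\<bar> * exp (- l\<^sub>0 / \<xi>)) * \<tau>)"
proof -
  define S' where "S' = region L l' j"
  define B where "B = region L b j"
  define D where "D = {i \<in> chain L. l' / 2 < \<bar>real i - real j\<bar> \<and> \<bar>real i - real j\<bar> \<le> l' / 2 + r}"
  let ?W = "circuit L dW gW" and ?V = "circuit L dV gV" and ?U = "\<lambda>S. evop h S \<tau>"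
  have b0: "0 \<le> b" by (rule order_trans[OF _ b]) simp
  have sub: "B \<subseteq> S'" "S' \<subseteq> S" "S \<subseteq> T" "D \<subseteq> T"
    unfolding B_def S'_def S_def T_def D_def using l' l
    by (auto intro!: region_mono region_subset_chain[THEN subsetD] simp: region_mono[THEN subsetD])
  have fin: "finite T" "finite S" "finite S'" "finite B"
    by (simp_all add: T_def S_def S'_def B_def)
  have jB: "j \<in> B" using j b0 by (simp add: B_def region_def)
  define A where "A = ?V T * (?W T * Pi0 j * adj (?W T)) * adj (?V T)"
  \<comment> \<open>One inclusion for each use of the light cones: \<open>W\<close> on the
    projector, then \<open>V\<close> on the result, and the adjoint of \<open>W\<close> on the
    operator evolved inside the region of diameter \<open>l'\<close>.\<close>
  have reach: "region L (0 + 2 * real (2 * dW)) j \<subseteq> S" "region L (0 + 2 * real (2 * dW) + 2 * real (2 * dV)) j \<subseteq> B"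
    "region L (l' + 2 * real (2 * dW)) j \<subseteq> S"
    unfolding B_def S_def using b l l' by (intro region_mono; simp)+
  have Pi: "supp (region L 0 j) (Pi0 j)" using region_0[OF j] supp_Pi0[of j] by simp
  note W_cone = circuit_lightcone[OF W, of j S] and V_cone = circuit_lightcone[OF V, of j S]
  note step1 = lightconeD[OF conjunct1[OF W_cone] Pi reach(1)]
  have "region L (0 + 2 * real (2 * dW) + 2 * real (2 * dV)) j \<subseteq> S" using reach(2) sub by blast
  note step2 = lightconeD[OF conjunct1[OF V_cone] step1(2) this]
  have A_S: "?V S * (?W S * Pi0 j * adj (?W S)) * adj (?V S) = A"
    using step1(1) step2(1) by (simp add: A_def T_def)
  have suppA: "supp B A"
    using supp_mono[OF step2(2) reach(2) fin(4)] A_S by simp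
  then have liftA: "lift B (entry A) = A" by (rule lift_entry)
  \<comment> \<open>\<open>A\<close> is a unitary conjugate of a projector, hence a projector, hence
    of norm at most 1 as the Lieb-Robinson bound demands.\<close>
  have "adj A * A = A"
  proof -
    let ?Q = "?V T * ?W T"
    have Q: "adj ?Q * ?Q = 1" by (intro unitopD unitop_mult unitop_circuit V W)
    have A: "A = ?Q * Pi0 j * adj ?Q" by (simp add: A_def adj_mult mult.assoc)
    have "adj A * A = ?Q * Pi0 j * (adj ?Q * ?Q) * Pi0 j * adj ?Q"
      unfolding A by (simp add: adj_mult adj_Pi0 mult.assoc)
    also have "\<dots> = ?Q * (Pi0 j * Pi0 j) * adj ?Q" unfolding Q by (simp add: mult.assoc)
    finally show ?thesis by (simp add: A Pi0_idem)
  qed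
  then have normA: "opnorm T (tens_id B (entry A)) \<le> 1"
    using fin sub liftA by (intro opnorm_projection_le) (auto simp: lift_tens_id)
  \<comment> \<open>Absolute values of \<open>C\<close> and \<open>J\<close> are used because their
    signs are not fixed, and the monotonicity steps below need nonnegative factors.\<close>
  define c where "c = \<bar>C\<bar> * exp (- l\<^sub>0 / \<xi>)"
  have herm: "hermitian X (h X)" if "X \<subseteq> T" for X
    using ham that by (simp add: local_hamiltonian_def T_def)
  have strength: "(\<Sum>X | X \<subseteq> T \<and> i \<in> X. opnorm T (tens_id X (h X))) \<le> \<bar>J\<bar>" if "i \<in> T" for i
    using ham that by (fastforce simp: local_hamiltonian_def T_def)
  have boundary: "X \<inter> D \<noteq> {} \<and>
      (\<forall>s. 0 \<le> s \<and> s \<le> \<tau> \<longrightarrow> C * exp (- (setdist (real ` B) (real ` X) - v * \<bar>s\<bar>) / \<xi>) \<le> c)"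
    if X: "X \<subseteq> T" "X \<inter> S' \<noteq> {}" "\<not> X \<subseteq> S'" "tens_id X (h X) \<noteq> (\<lambda>x y. 0)" for X
  proof -
    have "diameter (real ` X) \<le> r"
      using ham X by (auto simp: local_hamiltonian_def T_def)
    moreover have "bounded (real ` X)"
      using X(1) fin by (intro finite_imp_bounded finite_imageI) (auto dest: finite_subset)
    ultimately have diam: "\<bar>real x - real y\<bar> \<le> r" if "x \<in> X" "y \<in> X" for x y
      using diameter_bounded_bound[of "real ` X" "real x" "real y"] that by (simp add: dist_real_def)
    obtain i y where i: "i \<in> X" "i \<notin> S'" and y: "y \<in> X" "y \<in> S'" using X by blast
    have i_far: "l' / 2 < \<bar>real i - real j\<bar>"
      using i X(1) by (auto simp: S'_def T_def region_def dist_real_def abs_minus_commute)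
    moreover have "\<bar>real i - real j\<bar> \<le> l' / 2 + r"
    proof -
      have "dist (real i) (real j) \<le> dist (real i) (real y) + dist (real j) (real y)"
        by (rule dist_triangle2)
      then show ?thesis
        using diam[OF i(1) y(1)] y(2) by (simp add: S'_def region_def dist_real_def)
    qed
    ultimately have "i \<in> D" using i X(1) by (auto simp: D_def T_def)
    \<comment> \<open>From \<open>j\<close> it is more than \<open>l' / 2\<close> to the outer site
      \<open>i\<close> of \<open>X\<close>, at most \<open>b / 2\<close> to any site of
      \<open>B\<close>, and \<open>X\<close> has diameter at most \<open>r\<close>. What remains is
      at least \<open>l' / 2 - r - b / 2\<close>.\<close>
    have dist: "l\<^sub>0 + v * \<tau> \<le> setdist (real ` B) (real ` X)"
    proof (rule le_setdistI)
      fix p q assume "p \<in> real ` B" "q \<in> real ` X"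
      then obtain p' x where p': "p' \<in> B" "p = real p'" and x: "x \<in> X" "q = real x" by blast
      have "dist (real j) (real p') \<le> b / 2"
        using p' by (simp add: B_def region_def)
      moreover have "dist (real i) (real j) \<le> dist (real i) (real x) + dist (real p') (real x) + dist (real j) (real p')"
        using dist_triangle2[of "real i" "real j" "real x"] dist_triangle[of "real j" "real x" "real p'"] by linarith
      moreover have "dist (real i) (real x) \<le> r" "l' / 2 < dist (real i) (real j)"
        using diam[OF i(1) x(1)] i_far by (simp_all add: dist_real_def)
      moreover have "dist p q = dist (real p') (real x)" using p' x by simp
      ultimately have "l' / 2 \<le> r + dist p q + b / 2" by linarith
      then show "l\<^sub>0 + v * \<tau> \<le> dist p q"
        using l'(1) by (simp add: field_simps)
    qed (use jB y in auto)
    have "C * exp (- (setdist (real ` B) (real ` X) - v * \<bar>s\<bar>) / \<xi>) \<le> c" if s: "0 \<le> s" "s \<le> \<tau>" for s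
    proof -
      have "v * \<bar>s\<bar> \<le> v * \<tau>" using s v by (simp add: mult_left_mono)
      then have "- (setdist (real ` B) (real ` X) - v * \<bar>s\<bar>) / \<xi> \<le> - l\<^sub>0 / \<xi>"
        using dist \<xi> by (intro divide_right_mono) auto
      then show ?thesis
        unfolding c_def by (intro mult_mono) auto
    qed
    then show ?thesis using \<open>i \<in> D\<close> i by blast
  qed
  \<comment> \<open>Stated for general \<open>T'\<close>, since it is used with both the whole chain
    and the local subsystem.\<close>
  have bound: "cmod (entry (adj Q * (adj (?U T') * A * ?U T' - adj (?U S') * A * ?U S') * Q) {} {})
      \<le> 2 * (nat \<lceil>r\<rceil> + 1) * \<bar>J\<bar> * c * \<tau>"
    if T': "S' \<subseteq> T'" "T' \<subseteq> T" and Q: "supp T Q" "adj Q * Q = 1" for T' Q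
  proof -
    have adjU: "adj (?U T') = evop h T' (- \<tau>)" "adj (?U S') = evop h S' (- \<tau>)"
      using T' fin herm sub by (auto intro!: adj_evop dest: finite_subset)
    have "c \<ge> 0" by (simp add: c_def)
    have "cmod (entry (adj Q * (adj (?U T') * A * ?U T' - adj (?U S') * A * ?U S') * Q) {} {})
      \<le> card D * \<bar>J\<bar> * c * \<tau>"
      using restricted_evolution_error[OF fin(1) T' sub(1) _ sub(4) herm strength
          LR[folded S'_def T_def] \<tau> \<open>c \<ge> 0\<close> boundary normA Q] jB
      unfolding adjU liftA by blast
    also have "\<dots> \<le> 2 * (nat \<lceil>r\<rceil> + 1) * \<bar>J\<bar> * c * \<tau>"
      using card_annulus_le[OF r, of L "l' / 2" j] \<tau> \<open>c \<ge> 0\<close>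
      by (intro mult_right_mono) (auto simp: D_def simp flip: of_nat_mult of_nat_add)
    finally show ?thesis .
  qed
  define M where "M = adj (?U S') * A * ?U S'"
  have "supp S' M"
    unfolding M_def using fin sub suppA by (intro supp_mult supp_adj supp_evop) (auto intro: supp_mono)
  then have "supp (region L l' j) M" by (simp add: S'_def)
  note step3 = lightconeD(1)[OF conjunct2[OF W_cone] this reach(3)]
  have heis_T: "heis (?W T) (?U T) (?V T) j = adj (?W T) * (adj (?U T) * A * ?U T) * ?W T"
    by (simp add: heis_def A_def)
  have heis_S: "heis (?W S) (?U S) (?V S) j = adj (?W S) * (adj (?U S) * A * ?U S) * ?W S"
    by (simp add: heis_def A_S)
  \<comment> \<open>By \<open>step3\<close> conjugating \<open>M\<close> with the full or the
    restricted state preparation gives the same result, so \<open>M\<close> can be subtracted on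
    both sides.\<close>
  have "heis (?W T) (?U T) (?V T) j - heis (?W S) (?U S) (?V S) j =
      adj (?W T) * (adj (?U T) * A * ?U T - M) * ?W T - adj (?W S) * (adj (?U S) * A * ?U S - M) * ?W S"
    unfolding heis_T heis_S using step3 by (simp add: right_diff_distrib left_diff_distrib T_def)
  then have "cmod (entry (heis (?W T) (?U T) (?V T) j) {} {} - entry (heis (?W S) (?U S) (?V S) j) {} {}) =
      cmod (entry (adj (?W T) * (adj (?U T) * A * ?U T - M) * ?W T) {} {} -
        entry (adj (?W S) * (adj (?U S) * A * ?U S - M) * ?W S) {} {})"
    by (simp only: entry_minus[symmetric])
  also have "\<dots> \<le> cmod (entry (adj (?W T) * (adj (?U T) * A * ?U T - M) * ?W T) {} {}) +
        cmod (entry (adj (?W S) * (adj (?U S) * A * ?U S - M) * ?W S) {} {})"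
    by (rule norm_triangle_ineq4)
  also have "\<dots> \<le> 2 * (nat \<lceil>r\<rceil> + 1) * \<bar>J\<bar> * c * \<tau> + 2 * (nat \<lceil>r\<rceil> + 1) * \<bar>J\<bar> * c * \<tau>"
    unfolding M_def using sub fin
    by (intro add_mono bound unitopD unitop_circuit W supp_circuit supp_mono[OF supp_circuit]) auto
  finally show ?thesis by (simp add: c_def algebra_simps)
qed

theorem theorem1:
  fixes r\<^sub>H J v \<xi> C \<tau> R :: real and N d\<^sub>V D :: nat and d\<^sub>W :: "nat \<Rightarrow> nat"
  assumes "0 \<le> r\<^sub>H" and "0 \<le> v" and "0 < \<xi>" and "0 \<le> \<tau>" and "1 \<le> N"
    and D: "D = Max (d\<^sub>W ` {..<N})"
    and R: "R = 4 * (real d\<^sub>V + real D)"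
  shows "\<exists>K :: real. \<forall>(L :: nat) (h :: nat set \<Rightarrow> qop)
      (v\<^sub>g :: nat \<Rightarrow> nat \<Rightarrow> real \<Rightarrow> qop) (w\<^sub>g :: nat \<Rightarrow> nat \<Rightarrow> nat \<Rightarrow> qop)
      (l\<^sub>0 :: real) (L' :: real) (Lt :: real) (\<epsilon>\<^sub>o\<^sub>p\<^sub>t :: real) (\<theta>' :: nat \<Rightarrow> nat \<Rightarrow> real).
    let U = evol (chain L) (ham h (chain L)) \<tau>;
        V = (\<lambda>\<theta>. brickwall L d\<^sub>V (\<lambda>l i. v\<^sub>g l i (\<theta> l i)) (chain L));
        W = (\<lambda>k. brickwall L (d\<^sub>W k) (w\<^sub>g k) (chain L));
        \<Psi> = (\<lambda>k. op_apply (chain L) (W k) ket0);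
        \<epsilon>\<^sub>L\<^sub>R = K * exp (- (l\<^sub>0 + R / 2) / \<xi>)
    in even L \<longrightarrow>
       local_hamiltonian L r\<^sub>H J h \<longrightarrow>
       lieb_robinson (chain L) (ham h (chain L)) \<tau> C v \<xi> \<longrightarrow>
       (\<forall>l>0. \<forall>j\<in>chain L. lieb_robinson (chain L) (ham h (region L l j)) \<tau> C v \<xi>) \<longrightarrow>
       (\<forall>\<theta>. gates L d\<^sub>V (\<lambda>l i. v\<^sub>g l i (\<theta> l i))) \<longrightarrow>
       (\<forall>k<N. gates L (d\<^sub>W k) (w\<^sub>g k)) \<longrightarrow>
       lin_indep (chain L) N \<Psi> \<longrightarrow>
       pairwise_nonorth (chain L) N \<Psi> \<longrightarrow>
       0 \<le> l\<^sub>0 \<longrightarrow>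
       L' = 2 * (l\<^sub>0 + r\<^sub>H + v * \<tau> + 2 * (real d\<^sub>V + real D)) \<longrightarrow>
       L' < real L \<longrightarrow>
       L' < Lt \<longrightarrow>
       max (L' / 2 + 2 * (real d\<^sub>V + real D) + 1) (L' + 4 * real D) \<le> Lt \<longrightarrow>
       cost_local L Lt h \<tau> N d\<^sub>W w\<^sub>g d\<^sub>V (\<lambda>l i. v\<^sub>g l i (\<theta>' l i)) \<le> \<epsilon>\<^sub>o\<^sub>p\<^sub>t \<longrightarrow>
       cost_LLET_full L N W U (V \<theta>') \<le> \<epsilon>\<^sub>o\<^sub>p\<^sub>t + \<epsilon>\<^sub>L\<^sub>R \<and>
       cost_LET L N \<Psi> U (V \<theta>') \<le> real L * (\<epsilon>\<^sub>o\<^sub>p\<^sub>t + \<epsilon>\<^sub>L\<^sub>R)"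
proof -
  \<comment> \<open>Two comparisons, each with at most
    \<open>2 * (nat \<lceil>r\<^sub>H\<rceil> + 1)\<close> boundary sites of strength
    \<open>\<bar>J\<bar>\<close>, commutator prefactor \<open>\<bar>C\<bar>\<close> and duration
    \<open>\<tau>\<close>.\<close>
  define K\<^sub>0 where "K\<^sub>0 = 2 * (2 * (nat \<lceil>r\<^sub>H\<rceil> + 1) * \<bar>J\<bar> * \<bar>C\<bar> * \<tau>)"
  define K where "K = K\<^sub>0 * exp (R / 2 / \<xi>)"
  show ?thesis
    unfolding Let_def
  proof (rule exI[of _ K], intro allI impI)
    fix L h v\<^sub>g w\<^sub>g l\<^sub>0 L' Lt \<epsilon>\<^sub>o\<^sub>p\<^sub>t and \<theta>' :: "nat \<Rightarrow> nat \<Rightarrow> real"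
    assume ham: "local_hamiltonian L r\<^sub>H J h"
      and LR: "\<forall>l>0. \<forall>j\<in>chain L. lieb_robinson (chain L) (ham h (region L l j)) \<tau> C v \<xi>"
      and gV: "\<forall>\<theta>. gates L d\<^sub>V (\<lambda>l i. v\<^sub>g l i (\<theta> l i))"
      and gW: "\<forall>k<N. gates L (d\<^sub>W k) (w\<^sub>g k)"
      and l\<^sub>0: "0 \<le> l\<^sub>0"
      and L': "L' = 2 * (l\<^sub>0 + r\<^sub>H + v * \<tau> + 2 * (real d\<^sub>V + real D))" "L' < real L" "L' < Lt"
      and Lt: "max (L' / 2 + 2 * (real d\<^sub>V + real D) + 1) (L' + 4 * real D) \<le> Lt"
      and opt: "cost_local L Lt h \<tau> N d\<^sub>W w\<^sub>g d\<^sub>V (\<lambda>l i. v\<^sub>g l i (\<theta>' l i)) \<le> \<epsilon>\<^sub>o\<^sub>p\<^sub>t"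
    let ?T = "chain L" and ?g = "\<lambda>l i. v\<^sub>g l i (\<theta>' l i)"
    let ?U = "evol ?T (ham h ?T) \<tau>" and ?V = "brickwall L d\<^sub>V ?g ?T"
      and ?W = "\<lambda>k. brickwall L (d\<^sub>W k) (w\<^sub>g k) ?T"
    let ?\<epsilon> = "K * exp (- (l\<^sub>0 + R / 2) / \<xi>)"
    have v\<tau>: "0 \<le> v * \<tau>" using assms by simp
    \<comment> \<open>With \<open>L' < real L\<close> this gives at least one site, so the average
      over \<open>L\<close> sites is a genuine one.\<close>
    have "R \<le> L'" unfolding R L'(1) using v\<tau> l\<^sub>0 assms(1) by simp
    moreover have "0 \<le> R" by (simp add: R)
    ultimately have L0: "0 \<le> L'" "1 \<le> L" using L'(2) by linarith+
    have dW: "d\<^sub>W k \<le> D" if "k < N" for k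
      unfolding D using that by (intro Max_ge) auto
    have \<epsilon>: "?\<epsilon> = 2 * (2 * (nat \<lceil>r\<^sub>H\<rceil> + 1) * \<bar>J\<bar> * (\<bar>C\<bar> * exp (- l\<^sub>0 / \<xi>)) * \<tau>)"
    proof -
      have "exp (R / 2 / \<xi>) * exp (- (l\<^sub>0 + R / 2) / \<xi>) = exp (- l\<^sub>0 / \<xi>)"
        unfolding mult_exp_exp by (simp add: diff_divide_distrib add_divide_distrib)
      then show ?thesis by (simp add: K_def K\<^sub>0_def mult.assoc)
    qed
    have site: "cost_LLET ?T N ?W j ?U ?V \<le>
        cost_LLET (region L Lt j) N (\<lambda>k. brickwall L (d\<^sub>W k) (w\<^sub>g k) (region L Lt j)) j
          (evol (region L Lt j) (ham h (region L Lt j)) \<tau>) (brickwall L d\<^sub>V ?g (region L Lt j)) + ?\<epsilon>"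
      if j: "j \<in> ?T" for j
    proof -
      let ?S = "region L Lt j"
      define t where "t S k = Re (entry (heis (circuit L (d\<^sub>W k) (w\<^sub>g k) S) (evop h S \<tau>) (circuit L d\<^sub>V ?g S) j) {} {})"
        for S k
      have cost: "cost_LLET S N (\<lambda>k. brickwall L (d\<^sub>W k) (w\<^sub>g k) S) j (evol S (ham h S) \<tau>) (brickwall L d\<^sub>V ?g S)
          = 1 - (\<Sum>k<N. t S k) / N" if "finite S" "j \<in> S" for S
        using that by (simp add: cost_LLET_heis lift_brickwall lift_evol t_def)
      have jS: "j \<in> ?S" using j L0 L'(3) by (simp add: region_def)
      have "t ?S k - t ?T k \<le> ?\<epsilon>" if k: "k < N" for k
      proof -
        \<comment> \<open>The intermediate diameter \<open>Lt - 4 * real D\<close> is at least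
          \<open>L'\<close>. Its positivity, required by the assumption on local restrictions,
          follows from \<open>R \<le> L'\<close> if \<open>D\<close> is positive and from
          \<open>L' < Lt\<close> if \<open>D\<close> is 0.\<close>
        have l': "R \<le> Lt - 4 * real D" "0 < Lt - 4 * real D" "2 * (l\<^sub>0 + r\<^sub>H + v * \<tau>) + R \<le> Lt - 4 * real D"
          "Lt - 4 * real D + 4 * real (d\<^sub>W k) \<le> Lt" "4 * (real d\<^sub>V + real (d\<^sub>W k)) \<le> R"
          using \<open>R \<le> L'\<close> Lt L0 L' R dW[OF k] v\<tau> l\<^sub>0 assms(1) by auto
        have "cmod (entry (heis (circuit L (d\<^sub>W k) (w\<^sub>g k) ?T) (evop h ?T \<tau>) (circuit L d\<^sub>V ?g ?T) j) {} {} -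
            entry (heis (circuit L (d\<^sub>W k) (w\<^sub>g k) ?S) (evop h ?S \<tau>) (circuit L d\<^sub>V ?g ?S) j) {} {}) \<le> ?\<epsilon>"
          unfolding \<epsilon>
          by (rule local_heis_error[where b = R and l' = "Lt - 4 * real D"])
            (use assms j ham LR gV gW k l' in auto)
        then show ?thesis
          unfolding t_def by (smt (verit) abs_Re_le_cmod minus_complex.simps(1))
      qed
      then have "(\<Sum>k<N. t ?S k - t ?T k) \<le> (\<Sum>k<N. ?\<epsilon>)"
        by (intro sum_mono) simp
      then have "(\<Sum>k<N. t ?S k) / N - (\<Sum>k<N. t ?T k) / N \<le> ?\<epsilon>"
        using \<open>1 \<le> N\<close> by (simp add: sum_subtractf field_simps)
      then show ?thesis
        unfolding cost[OF finite_chain j] cost[OF finite_region jS] by linarith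
    qed
    have "cost_LLET_full L N ?W ?U ?V \<le> cost_local L Lt h \<tau> N d\<^sub>W w\<^sub>g d\<^sub>V ?g + ?\<epsilon>"
    proof -
      have "(\<Sum>j=1..L. cost_LLET ?T N ?W j ?U ?V) \<le> (\<Sum>j=1..L.
        cost_LLET (region L Lt j) N (\<lambda>k. brickwall L (d\<^sub>W k) (w\<^sub>g k) (region L Lt j)) j
          (evol (region L Lt j) (ham h (region L Lt j)) \<tau>) (brickwall L d\<^sub>V ?g (region L Lt j)) + ?\<epsilon>)"
        using site by (intro sum_mono) (simp add: chain_def)
      then show ?thesis
        using L0 by (simp add: cost_LLET_full_def cost_local_def Let_def sum.distrib field_simps)
    qed
    then have full: "cost_LLET_full L N ?W ?U ?V \<le> \<epsilon>\<^sub>o\<^sub>p\<^sub>t + ?\<epsilon>"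
      using opt by linarith
    have "unitop (lift ?T ?U)"
    proof -
      have "adj (evop h ?T \<tau>) = evop h ?T (- \<tau>)"
        using ham by (intro adj_evop) (auto simp: local_hamiltonian_def)
      then show ?thesis by (simp add: lift_evol unitop_def evop_inverse)
    qed
    then have "cost_LET L N (\<lambda>k. op_apply ?T (?W k) ket0) ?U ?V \<le> L * cost_LLET_full L N ?W ?U ?V"
      using gV gW by (intro cost_LET_le \<open>1 \<le> N\<close> L0) (auto simp: lift_brickwall intro!: unitop_circuit)
    also have "\<dots> \<le> L * (\<epsilon>\<^sub>o\<^sub>p\<^sub>t + ?\<epsilon>)"
      using full by (intro mult_left_mono) auto
    finally show "cost_LLET_full L N ?W ?U ?V \<le> \<epsilon>\<^sub>o\<^sub>p\<^sub>t + ?\<epsilon> \<and>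
        cost_LET L N (\<lambda>k. op_apply ?T (?W k) ket0) ?U ?V \<le> real L * (\<epsilon>\<^sub>o\<^sub>p\<^sub>t + ?\<epsilon>)"
      using full by blast
  qed
qed

end
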